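(* Let $\Lambda_1$ and $\Lambda_2$ be single vertex 2-graphs with generating edge multiplicities $2,3$ and suppose that the relations for these 2-graphs are of cyclic type (or, equivalently, that each $\mathcal A_{\Lambda_i}$ has Gelfand space of minimal type). Then the norm closed Toeplitz algebras $\mathcal A_{\Lambda_1}$, $\mathcal A_{\Lambda_2}$ are isometrically isomorphic if and only if the 2-graphs $\Lambda_1$ and $\Lambda_2$ are isomorphic. Moreover there are exactly $14$ isomorphism classes, and these are in correspondence with the following $14$ permutations (in cycle notation on the cells $1,\dots,6$ of the $2\times 3$ rectangle): $$(1\,5\,3\,4\,2\,6),\ (1\,4\,2\,5\,3\,6),\ (1\,5\,3\,6\,2\,4),\ (1\,2\,3\,6\,5\,4),\ (1\,4\,2\,5\,6\,3),\ (1\,2\,5\,4\,3\,6),\ (1\,2\,3\,4\,5\,6),$$ $$(1\,2\,3\,4\,6\,5),\ (1\,2\,4\,5\,3\,6),\ (1\,2\,4\,5\,6\,3),\ (1\,5\,4\,2\,3\,6),\ (1\,2\,4\,6\,5\,3),\ (1\,5\,4\,2\,6\,3),\ (1\,2\,6\,4\,3\,5).$$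
   Context: A single vertex 2-graph $\Lambda$ with generating edge multiplicities $n,m$ is identified with a unital semigroup $\mathbb F_n^+\times_\theta\mathbb F_m^+$, where $\theta$ is a permutation of $\{1,\dots,n\}\times\{1,\dots,m\}$: it is generated by $e_1,\dots,e_n,f_1,\dots,f_m$ subject only to the relations $e_if_j=f_{j'}e_{i'}$ whenever $\theta(i,j)=(i',j')$. (It is left and right cancellative.) Two such 2-graphs are isomorphic if these semigroups are isomorphic; for $n\ne m$ this is the same as product conjugacy of the permutations, i.e. conjugacy in $S_{nm}$ by an element of the subgroup $S_n\times S_m$. The relations are of cyclic type if $\theta$ is a single cycle of order $nm$ (here a $6$-cycle in $S_6$). For $(n,m)=(2,3)$ the pairs $(1,1),(1,2),(1,3),(2,1),(2,2),(2,3)$ are labelled $1,2,3,4,5,6$ respectively (first row $1,2,3$, second row $4,5,6$), and $(a\,b\,c\,\dots)$ denotes the cycle $a\to b\to c\to\dots\to a$. The Fock space is the Hilbert space with orthonormal basis $\{\xi_w\}$ indexed by the elements $w$ of the semigroup; $L_v\xi_w=\xi_{vw}$ defines isometries $L_v$, and $\mathcal A_\Lambda$ is the norm closed operator algebra generated by all the $L_w$. Isometrically isomorphic means that there is an isometric algebra isomorphism. The Gelfand (character) space of $\mathcal A_\Lambda$ is identified with $\Omega_\theta$, the set of points $(z,w)\in\overline{\mathbb B}_n\times\overline{\mathbb B}_m$ (closed Euclidean unit balls of $\mathbb C^n$, $\mathbb C^m$) with $z_iw_j=z_{i'}w_{j'}$ whenever $\theta(i,j)=(i',j')$. It is of minimal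 type if $\Omega_\theta=(\overline{\mathbb B}_n\times\{0\})\cup(\{0\}\times\overline{\mathbb B}_m)\cup\big((\overline{\mathbb B}_n\cap E_n)\times(\overline{\mathbb B}_m\cap E_m)\big)$, where $E_d=\{z\in\mathbb C^d:z_1=\dots=z_d\}$.
   Formalization: Cyclic type implies minimal type but not conversely, e.g. (1 5)(2 3 4 6) has minimal Gelfand space; so only that implication is stated, the isomorphism criterion is given when both graphs are cyclic or both minimal, and the count of 14 classes is for cyclic type. *)

theory Defs
  imports "HOL-Analysis.Analysis" "HOL-Algebra.Group" "HOL-Combinatorics.Cycles"
begin

section \<open>Single vertex 2-graphs\<close>

text \<open>
  The index sets \<open>{1..n}\<close> and \<open>{1..m}\<close> are rendered by finite types \<^typ>\<open>'n\<close> and \<^typ>\<open>'m\<close>.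
  A word is a list over \<^typ>\<open>'n + 'm\<close>, where \<open>Inl i\<close> stands for \<open>e\<^sub>i\<close> and \<open>Inr j\<close> for \<open>f\<^sub>j\<close>.
\<close>

inductive word_cong :: "('n \<times> 'm \<Rightarrow> 'n \<times> 'm) \<Rightarrow> ('n + 'm) list \<Rightarrow> ('n + 'm) list \<Rightarrow> bool"
  for \<theta> where
  commute: "\<theta> (i, j) = (i', j') \<Longrightarrow>
      word_cong \<theta> (u @ [Inl i, Inr j] @ v) (u @ [Inr j', Inl i'] @ v)"
| refl: "word_cong \<theta> u u"
| sym: "word_cong \<theta> u v \<Longrightarrow> word_cong \<theta> v u"
| trans: "word_cong \<theta> u v \<Longrightarrow> word_cong \<theta> v w \<Longrightarrow> word_cong \<theta> u w"

definition two_graph :: "('n \<times> 'm \<Rightarrow> 'n \<times> 'm) \<Rightarrow> ('n + 'm) list set monoid" where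
  "two_graph \<theta> =
    \<lparr>carrier = UNIV // {(u, v). word_cong \<theta> u v},
     mult = (\<lambda>X Y. \<Union>u\<in>X. \<Union>v\<in>Y. {w. word_cong \<theta> (u @ v) w}),
     one = {w. word_cong \<theta> [] w}\<rparr>"

lemma word_cong_context: "word_cong \<theta> u v \<Longrightarrow> word_cong \<theta> (a @ u @ b) (a @ v @ b)"
proof (induction rule: word_cong.induct)
  case (commute i j i' j' u v)
  then show ?case
    using word_cong.commute[of \<theta> i j i' j' "a @ u" "v @ b"] by simp
qed (blast intro: word_cong.refl word_cong.sym word_cong.trans)+

lemma word_cong_append:
  "word_cong \<theta> u u' \<Longrightarrow> word_cong \<theta> v v' \<Longrightarrow> word_cong \<theta> (u @ v) (u' @ v')"
  using word_cong_context[of \<theta> u u' "[]" v] word_cong_context[of \<theta> v v' u' "[]"]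
  by (metis append_Nil append_Nil2 word_cong.trans)

lemma two_graph_carrier: "carrier (two_graph \<theta>) = range (\<lambda>u. {w. word_cong \<theta> u w})"
  by (auto simp: two_graph_def quotient_def)

lemma two_graph_mult:
  "{w. word_cong \<theta> u w} \<otimes>\<^bsub>two_graph \<theta>\<^esub> {w. word_cong \<theta> v w} = {w. word_cong \<theta> (u @ v) w}"
proof -
  have "word_cong \<theta> (u @ v) w" if "word_cong \<theta> u u'" "word_cong \<theta> v v'" "word_cong \<theta> (u' @ v') w"
    for u' v' w
    using word_cong_append[OF that(1,2)] that(3) by (rule word_cong.trans)
  then show ?thesis
    by (auto simp: two_graph_def intro: word_cong.refl)
qed

text \<open>
  Every word is congruent to a unique word \<open>e\<^sub>u f\<^sub>v\<close>.  The left action of the generators on these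
  normal forms is injective, which gives left cancellation.
\<close>

primrec push :: "('n \<times> 'm \<Rightarrow> 'n \<times> 'm) \<Rightarrow> 'm \<Rightarrow> 'n list \<Rightarrow> 'n list \<times> 'm" where
  "push \<theta> j [] = ([], j)"
| "push \<theta> j (a # u) = (let (i, k) = inv_into UNIV \<theta> (a, j); (u', l) = push \<theta> k u in (i # u', l))"

fun act :: "('n \<times> 'm \<Rightarrow> 'n \<times> 'm) \<Rightarrow> 'n + 'm \<Rightarrow> 'n list \<times> 'm list \<Rightarrow> 'n list \<times> 'm list" where
  "act \<theta> (Inl i) (u, v) = (i # u, v)"
| "act \<theta> (Inr j) (u, v) = (let (u', l) = push \<theta> j u in (u', l # v))"

lemma word_cong_act:
  assumes "bij \<theta>"
  shows "word_cong \<theta> u v \<Longrightarrow> foldr (act \<theta>) u s = foldr (act \<theta>) v s"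
proof (induction arbitrary: s rule: word_cong.induct)
  case (commute i j i' j' u v)
  then have "inv_into UNIV \<theta> (i', j') = (i, j)"
    using assms by (metis bij_inv_eq_iff)
  then show ?case
    by (cases "foldr (act \<theta>) v s") (simp add: Let_def split: prod.splits)
qed auto

lemma word_cong_push:
  assumes "bij \<theta>"
  shows "word_cong \<theta> (Inr j # map Inl u) (map Inl (fst (push \<theta> j u)) @ [Inr (snd (push \<theta> j u))])"
proof (induction u arbitrary: j)
  case (Cons a u)
  obtain i k where ik: "inv_into UNIV \<theta> (a, j) = (i, k)"
    by fastforce
  then have "\<theta> (i, k) = (a, j)"
    using assms by (metis bij_inv_eq_iff)
  then have "word_cong \<theta> (Inr j # Inl a # map Inl u) (Inl i # Inr k # map Inl u)"
    using word_cong.commute[of \<theta> i k a j "[]" "map Inl u"] by (simp add: word_cong.sym)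
  moreover have "word_cong \<theta> (Inl i # Inr k # map Inl u)
      (Inl i # map Inl (fst (push \<theta> k u)) @ [Inr (snd (push \<theta> k u))])"
    using word_cong_context[OF Cons.IH[of k], of "[Inl i]" "[]"] by simp
  ultimately have "word_cong \<theta> (Inr j # Inl a # map Inl u)
      (Inl i # map Inl (fst (push \<theta> k u)) @ [Inr (snd (push \<theta> k u))])"
    by (rule word_cong.trans)
  then show ?case
    by (simp add: ik case_prod_unfold Let_def)
qed (simp add: word_cong.refl)

lemma word_cong_normal_form:
  assumes "bij \<theta>" "foldr (act \<theta>) w ([], []) = (u, v)"
  shows "word_cong \<theta> w (map Inl u @ map Inr v)"
  using assms(2)
proof (induction w arbitrary: u v)
  case (Cons x w)
  obtain u' v' where uv': "foldr (act \<theta>) w ([], []) = (u', v')"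
    by fastforce
  have *: "word_cong \<theta> (x # w) (x # map Inl u' @ map Inr v')"
    using word_cong_context[OF Cons.IH[OF uv'], of "[x]" "[]"] by simp
  show ?case
  proof (cases x)
    case (Inl i)
    then show ?thesis
      using * Cons.prems uv' by auto
  next
    case (Inr j)
    have "word_cong \<theta> (x # map Inl u' @ map Inr v') (map Inl u @ map Inr v)"
      using word_cong_context[OF word_cong_push[OF assms(1), of j u'], of "[]" "map Inr v'"]
        Cons.prems uv' Inr by (auto split: prod.splits)
    with * show ?thesis
      by (rule word_cong.trans)
  qed
qed (simp add: word_cong.refl)

lemma push_inject:
  assumes "bij \<theta>"
  shows "push \<theta> j u = push \<theta> k v \<Longrightarrow> j = k \<and> u = v"
proof (induction u arbitrary: j k v)
  case Nil
  then show ?case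
    by (cases v) (auto simp: Let_def split: prod.splits)
next
  case (Cons a u)
  then obtain b v' where v: "v = b # v'"
    by (cases v) (auto simp: Let_def split: prod.splits)
  obtain i l where il: "inv_into UNIV \<theta> (a, j) = (i, l)" by fastforce
  obtain i' l' where il': "inv_into UNIV \<theta> (b, k) = (i', l')" by fastforce
  have "i = i'" "push \<theta> l u = push \<theta> l' v'"
    using Cons.prems by (auto simp: v il il' split: prod.splits)
  then have "i = i'" "l = l'" "u = v'"
    using Cons.IH by blast+
  then have "inv_into UNIV \<theta> (a, j) = inv_into UNIV \<theta> (b, k)"
    by (simp add: il il')
  then have "(a, j) = (b, k)"
    using assms by (metis bij_inv_eq_iff)
  then show ?case
    by (simp add: v \<open>u = v'\<close>)
qed

lemma act_inject:
  assumes "bij \<theta>" "act \<theta> x s = act \<theta> x t"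
  shows "s = t"
proof (cases x)
  case (Inl i)
  then show ?thesis
    using assms(2) by (cases s; cases t) auto
next
  case (Inr j)
  then show ?thesis
    using assms(2) push_inject[OF assms(1)]
    by (cases s; cases t) (auto split: prod.splits, metis+)
qed

lemma word_cong_cancel_left:
  assumes "bij \<theta>" "word_cong \<theta> (u @ v) (u @ w)"
  shows "word_cong \<theta> v w"
proof -
  have inj: "s = t" if "foldr (act \<theta>) u s = foldr (act \<theta>) u t" for s t
    using that by (induction u) (auto dest: act_inject[OF assms(1)])
  have "foldr (act \<theta>) (u @ v) ([], []) = foldr (act \<theta>) (u @ w) ([], [])"
    by (rule word_cong_act[OF assms])
  then have "foldr (act \<theta>) v ([], []) = foldr (act \<theta>) w ([], [])"
    by (auto intro: inj)
  moreover obtain p q where pq: "foldr (act \<theta>) w ([], []) = (p, q)"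
    by fastforce
  ultimately have "word_cong \<theta> v (map Inl p @ map Inr q)" "word_cong \<theta> w (map Inl p @ map Inr q)"
    by (auto intro: word_cong_normal_form[OF assms(1)])
  then show ?thesis
    by (rule word_cong.trans[OF _ word_cong.sym])
qed

lemma two_graph_left_cancel:
  assumes "bij \<theta>" "v \<in> carrier (two_graph \<theta>)"
  shows "inj_on (\<lambda>w. v \<otimes>\<^bsub>two_graph \<theta>\<^esub> w) (carrier (two_graph \<theta>))"
proof (rule inj_onI)
  fix x y
  assume "x \<in> carrier (two_graph \<theta>)" "y \<in> carrier (two_graph \<theta>)"
    and eq: "v \<otimes>\<^bsub>two_graph \<theta>\<^esub> x = v \<otimes>\<^bsub>two_graph \<theta>\<^esub> y"
  then obtain a b c where abc: "v = {w. word_cong \<theta> a w}" "x = {w. word_cong \<theta> b w}"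
      "y = {w. word_cong \<theta> c w}"
    using assms(2) by (auto simp: two_graph_carrier)
  have "word_cong \<theta> (a @ b) (a @ c)"
    using eq word_cong.refl[of \<theta> "a @ c"] by (auto simp: abc two_graph_mult)
  then have "word_cong \<theta> b c"
    by (rule word_cong_cancel_left[OF assms(1)])
  then show "x = y"
    unfolding abc using word_cong.trans[of \<theta> b c] word_cong.trans[of \<theta> c b] word_cong.sym[of \<theta> b c]
    by blast
qed

definition cyclic_type :: "('c \<Rightarrow> 'c) \<Rightarrow> bool" where
  "cyclic_type \<theta> \<longleftrightarrow> (\<exists>cs. cycle cs \<and> set cs = UNIV \<and> \<theta> = cycle_of_list cs)"

section \<open>The Hilbert space of square summable families\<close>

typedef 'a ell2 = "{x :: 'a \<Rightarrow> complex. (\<lambda>i. (cmod (x i))\<^sup>2) summable_on UNIV}"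
  morphisms coeff Abs_ell2
  by (rule exI[of _ "\<lambda>_. 0"]) simp

lemma coeff_summable: "(\<lambda>i. (cmod (coeff x i))\<^sup>2) summable_on UNIV"
  using coeff[of x] by simp

lemma coeff_Abs: "(\<lambda>i. (cmod (x i))\<^sup>2) summable_on UNIV \<Longrightarrow> coeff (Abs_ell2 x) = x"
  by (simp add: Abs_ell2_inverse)

lemma ell2_eqI: "(\<And>i. coeff x i = coeff y i) \<Longrightarrow> x = y"
  by (metis coeff_inject ext)

lemma square_summable_add:
  fixes x y :: "'a \<Rightarrow> complex"
  assumes "(\<lambda>i. (cmod (x i))\<^sup>2) summable_on A" "(\<lambda>i. (cmod (y i))\<^sup>2) summable_on A"
  shows "(\<lambda>i. (cmod (x i + y i))\<^sup>2) summable_on A"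
proof (rule summable_on_comparison_test)
  show "(\<lambda>i. 2 * (cmod (x i))\<^sup>2 + 2 * (cmod (y i))\<^sup>2) summable_on A"
    by (intro summable_on_add summable_on_cmult_right assms)
  fix i
  have "(cmod (x i + y i))\<^sup>2 \<le> (cmod (x i) + cmod (y i))\<^sup>2"
    by (intro power_mono norm_triangle_ineq) simp
  also have "\<dots> \<le> 2 * (cmod (x i))\<^sup>2 + 2 * (cmod (y i))\<^sup>2"
    using sum_squares_bound[of "cmod (x i)" "cmod (y i)"] by (simp add: power2_sum)
  finally show "(cmod (x i + y i))\<^sup>2 \<le> 2 * (cmod (x i))\<^sup>2 + 2 * (cmod (y i))\<^sup>2" .
qed simp

lemma square_summable_scale:
  fixes x :: "'a \<Rightarrow> complex"
  assumes "(\<lambda>i. (cmod (x i))\<^sup>2) summable_on A"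
  shows "(\<lambda>i. (cmod (c * x i))\<^sup>2) summable_on A"
  using summable_on_cmult_right[OF assms, of "(cmod c)\<^sup>2"]
  by (simp add: norm_mult power_mult_distrib)

lemma inner_summable:
  fixes x y :: "'a \<Rightarrow> complex"
  assumes "(\<lambda>i. (cmod (x i))\<^sup>2) summable_on A" "(\<lambda>i. (cmod (y i))\<^sup>2) summable_on A"
  shows "(\<lambda>i. inner (x i) (y i)) summable_on A"
proof -
  have "(\<lambda>i. norm (inner (x i) (y i))) summable_on A"
  proof (rule summable_on_comparison_test)
    show "(\<lambda>i. (cmod (x i))\<^sup>2 + (cmod (y i))\<^sup>2) summable_on A"
      by (intro summable_on_add assms)
    fix i
    have "norm (inner (x i) (y i)) \<le> cmod (x i) * cmod (y i)"
      using Cauchy_Schwarz_ineq2 by simp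
    also have "\<dots> \<le> (cmod (x i))\<^sup>2 + (cmod (y i))\<^sup>2"
      using sum_squares_bound[of "cmod (x i)" "cmod (y i)"]
        mult_nonneg_nonneg[OF norm_ge_zero[of "x i"] norm_ge_zero[of "y i"]] by linarith
    finally show "norm (inner (x i) (y i)) \<le> (cmod (x i))\<^sup>2 + (cmod (y i))\<^sup>2" .
  qed simp
  then show ?thesis
    by (rule abs_summable_summable)
qed

text \<open>
  The inner product of the library's class is the real part of the complex one; the norm is the
  usual Hilbert space norm.
\<close>

instantiation ell2 :: (type) real_inner
begin

definition "0 = Abs_ell2 (\<lambda>_. 0)"
definition "x + y = Abs_ell2 (\<lambda>i. coeff x i + coeff y i)"
definition "- x = Abs_ell2 (\<lambda>i. - coeff x i)"
definition "(x :: 'a ell2) - y = x + (- y)"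
definition "r *\<^sub>R x = Abs_ell2 (\<lambda>i. r *\<^sub>R coeff x i)"
definition "inner x y = (\<Sum>\<^sub>\<infinity>i. inner (coeff x i) (coeff y i))"
definition "norm x = sqrt (\<Sum>\<^sub>\<infinity>i. (cmod (coeff x i))\<^sup>2)"
definition "sgn x = inverse (norm x) *\<^sub>R (x :: 'a ell2)"
definition "dist x y = norm (x - y :: 'a ell2)"
definition "(uniformity :: ('a ell2 \<times> 'a ell2) filter) =
  (INF e\<in>{0 <..}. principal {(x, y). dist x y < e})"
definition "open U \<longleftrightarrow>
  (\<forall>x\<in>U. eventually (\<lambda>(x', y). x' = x \<longrightarrow> y \<in> U) (uniformity :: ('a ell2 \<times> 'a ell2) filter))"

lemma coeff_zero: "coeff 0 = (\<lambda>_. 0)"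
  unfolding zero_ell2_def by (rule coeff_Abs) simp

lemma coeff_plus: "coeff (x + y) = (\<lambda>i. coeff x i + coeff y i)"
  unfolding plus_ell2_def by (intro coeff_Abs square_summable_add coeff_summable)

lemma coeff_uminus: "coeff (- x) = (\<lambda>i. - coeff x i)"
  unfolding uminus_ell2_def by (intro coeff_Abs) (simp add: coeff_summable)

lemma coeff_minus: "coeff (x - y) = (\<lambda>i. coeff x i - coeff y i)"
  unfolding minus_ell2_def by (simp add: coeff_plus coeff_uminus)

lemma coeff_scaleR: "coeff (r *\<^sub>R x) = (\<lambda>i. r *\<^sub>R coeff x i)"
  unfolding scaleR_ell2_def scaleR_conv_of_real
  by (intro coeff_Abs square_summable_scale coeff_summable)

instance
proof
  fix x y z :: "'a ell2" and r s :: real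
  note coeffs = coeff_zero coeff_plus coeff_uminus coeff_minus coeff_scaleR
  note summ = inner_summable[OF coeff_summable coeff_summable]
  show "x + y + z = x + (y + z)" "x + y = y + x" "0 + x = x" "- x + x = 0"
    by (auto intro!: ell2_eqI simp: coeffs)
  show "x - y = x + - y"
    by (rule minus_ell2_def)
  show "r *\<^sub>R (x + y) = r *\<^sub>R x + r *\<^sub>R y" "(r + s) *\<^sub>R x = r *\<^sub>R x + s *\<^sub>R x"
    "r *\<^sub>R s *\<^sub>R x = (r * s) *\<^sub>R x" "1 *\<^sub>R x = x"
    by (auto intro!: ell2_eqI simp: coeffs algebra_simps)
  show "dist x y = norm (x - y)"
    by (rule dist_ell2_def)
  show "sgn x = inverse (norm x) *\<^sub>R x"
    by (rule sgn_ell2_def)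
  show "(uniformity :: ('a ell2 \<times> 'a ell2) filter) =
      (INF e\<in>{0 <..}. principal {(x, y). dist x y < e})"
    by (rule uniformity_ell2_def)
  show "open U \<longleftrightarrow> (\<forall>x\<in>U. eventually (\<lambda>(x', y). x' = x \<longrightarrow> y \<in> U) uniformity)"
    for U :: "'a ell2 set"
    by (rule open_ell2_def)
  show "inner x y = inner y x"
    by (simp add: inner_ell2_def inner_commute)
  show "inner (x + y) z = inner x z + inner y z"
    by (simp add: inner_ell2_def coeffs inner_add_left infsum_add summ)
  show "inner (r *\<^sub>R x) y = r * inner x y"
    unfolding inner_ell2_def coeffs inner_scaleR_left by (rule infsum_cmult_right) (rule summ)
  show "0 \<le> inner x x"
    unfolding inner_ell2_def by (rule infsum_nonneg) simp
  show "inner x x = 0 \<longleftrightarrow> x = 0"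
  proof
    assume "inner x x = 0"
    then have "inner (coeff x i) (coeff x i) = 0" for i
      unfolding inner_ell2_def
      by (intro nonneg_infsum_le_0D[where A = UNIV and f = "\<lambda>i. inner (coeff x i) (coeff x i)"])
        (auto intro: summ)
    then show "x = 0"
      by (intro ell2_eqI) (simp add: coeffs)
  qed (simp add: inner_ell2_def coeffs)
  show "norm x = sqrt (inner x x)"
    by (simp add: norm_ell2_def inner_ell2_def power2_norm_eq_inner)
qed

end

definition ket :: "'a \<Rightarrow> 'a ell2" where
  "ket w = Abs_ell2 (\<lambda>u. if u = w then 1 else 0)"

definition cscale :: "complex \<Rightarrow> 'a ell2 \<Rightarrow>\<^sub>L 'a ell2" where
  "cscale c = Blinfun (\<lambda>x. Abs_ell2 (\<lambda>i. c * coeff x i))"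

lemma coeff_ket: "coeff (ket w) = (\<lambda>u. if u = w then 1 else 0)"
  unfolding ket_def
proof (rule coeff_Abs)
  have "(\<lambda>i. (cmod (if i = w then 1 else 0))\<^sup>2) summable_on {w}"
    by simp
  then show "(\<lambda>i. (cmod (if i = w then 1 else 0))\<^sup>2) summable_on UNIV"
    by (rule summable_on_cong_neutral[THEN iffD1, rotated -1]) auto
qed

lemma coeff_cscale: "coeff (cscale c x) i = c * coeff x i"
proof -
  let ?f = "\<lambda>x :: 'a ell2. Abs_ell2 (\<lambda>i. c * coeff x i)"
  have f: "coeff (?f x) = (\<lambda>i. c * coeff x i)" for x
    by (intro coeff_Abs square_summable_scale coeff_summable)
  have "bounded_linear ?f"
  proof (rule bounded_linear_intro)
    show "norm (?f x) \<le> norm x * cmod c" for x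
    proof -
      have "(\<Sum>\<^sub>\<infinity>i. (cmod (c * coeff x i))\<^sup>2) = (cmod c)\<^sup>2 * (\<Sum>\<^sub>\<infinity>i. (cmod (coeff x i))\<^sup>2)"
        unfolding norm_mult power_mult_distrib by (rule infsum_cmult_right) (rule coeff_summable)
      then show ?thesis
        by (simp add: norm_ell2_def f real_sqrt_mult)
    qed
  qed (rule ell2_eqI, simp only: f, simp add: f coeff_plus coeff_scaleR algebra_simps)+
  then show ?thesis
    by (simp add: cscale_def bounded_linear_Blinfun_apply f)
qed

section \<open>Toeplitz algebras\<close>

text \<open>
  The Fock space of a monoid \<open>G\<close> is the closed subspace of \<^typ>\<open>'a ell2\<close> spanned by the vectors
  \<^term>\<open>ket w\<close> with \<^term>\<open>w \<in> carrier G\<close>.  Operators on it are identified with the operators on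
  \<^typ>\<open>'a ell2\<close> that map into it and vanish on its orthogonal complement; this identification
  preserves the algebraic operations and the operator norm.  In particular \<open>creation G \<one>\<close>, the
  identity operator on the Fock space, becomes the projection onto that subspace.

  In \<open>creation G v\<close> the \<open>u\<close>-th coefficient of the image of \<open>\<Sum>x\<^sub>w \<xi>\<^sub>w\<close> is the sum of the \<open>x\<^sub>w\<close>
  with \<open>vw = u\<close>. There is at most one such \<open>w\<close> if \<open>G\<close> is left cancellative; see \<open>creation_ket\<close>
  and \<open>two_graph_creation_ket\<close> below.
\<close>

definition creation :: "'a monoid \<Rightarrow> 'a \<Rightarrow> 'a ell2 \<Rightarrow>\<^sub>L 'a ell2" where
  "creation G v = Blinfun (\<lambda>x. Abs_ell2
     (\<lambda>u. \<Sum>w | w \<in> carrier G \<and> v \<otimes>\<^bsub>G\<^esub> w = u. coeff x w))"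

lemma coeff_creation:
  assumes "inj_on (\<lambda>w. v \<otimes>\<^bsub>G\<^esub> w) (carrier G)"
  shows "coeff (creation G v x) u = (\<Sum>w | w \<in> carrier G \<and> v \<otimes>\<^bsub>G\<^esub> w = u. coeff x w)"
proof -
  let ?m = "\<lambda>w. v \<otimes>\<^bsub>G\<^esub> w" and ?C = "carrier G"
  let ?g = "\<lambda>x u. \<Sum>w | w \<in> ?C \<and> ?m w = u. coeff x w"
  have g_in: "?g x (?m w) = coeff x w" if "w \<in> ?C" for x w
  proof -
    have "{w'. w' \<in> ?C \<and> ?m w' = ?m w} = {w}"
      using assms that by (auto dest: inj_onD)
    then show ?thesis by simp
  qed
  have g_out: "?g x u = 0" if "u \<notin> ?m ` ?C" for x u
  proof -
    have "{w. w \<in> ?C \<and> ?m w = u} = {}"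
      using that by auto
    then show ?thesis by (metis sum.empty)
  qed
  have "(\<lambda>u. (cmod (?g x u))\<^sup>2) summable_on UNIV \<and>
      (\<Sum>\<^sub>\<infinity>u. (cmod (?g x u))\<^sup>2) \<le> (\<Sum>\<^sub>\<infinity>u. (cmod (coeff x u))\<^sup>2)" for x
  proof -
    have C: "(\<lambda>w. (cmod (coeff x w))\<^sup>2) summable_on ?C"
      using coeff_summable by (rule summable_on_subset_banach) simp
    have comp: "(\<lambda>u. (cmod (?g x u))\<^sup>2) (?m w) = (cmod (coeff x w))\<^sup>2" if "w \<in> ?C" for w
      using g_in[OF that] by simp
    have "((\<lambda>u. (cmod (?g x u))\<^sup>2) \<circ> ?m) summable_on ?C"
      using C comp by (subst summable_on_cong[where g = "\<lambda>w. (cmod (coeff x w))\<^sup>2"]) auto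
    then have "(\<lambda>u. (cmod (?g x u))\<^sup>2) summable_on ?m ` ?C"
      by (subst summable_on_reindex[OF assms])
    then have 1: "(\<lambda>u. (cmod (?g x u))\<^sup>2) summable_on UNIV"
      by (rule summable_on_cong_neutral[THEN iffD1, rotated -1]) (auto simp: g_out)
    have "(\<Sum>\<^sub>\<infinity>u. (cmod (?g x u))\<^sup>2) = (\<Sum>\<^sub>\<infinity>u\<in>?m ` ?C. (cmod (?g x u))\<^sup>2)"
      by (rule infsum_cong_neutral) (auto simp: g_out)
    also have "\<dots> = infsum ((\<lambda>u. (cmod (?g x u))\<^sup>2) \<circ> ?m) ?C"
      by (rule infsum_reindex[OF assms])
    also have "\<dots> = (\<Sum>\<^sub>\<infinity>w\<in>?C. (cmod (coeff x w))\<^sup>2)"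
      using comp by (intro infsum_cong) auto
    also have "\<dots> \<le> (\<Sum>\<^sub>\<infinity>w. (cmod (coeff x w))\<^sup>2)"
      by (intro infsum_mono_neutral C coeff_summable) auto
    finally show ?thesis
      using 1 by blast
  qed
  note summ = this
  have g: "coeff (Abs_ell2 (?g x)) = ?g x" for x
    by (rule coeff_Abs) (use summ in blast)
  have "bounded_linear (\<lambda>x. Abs_ell2 (?g x))"
  proof (rule bounded_linear_intro[where K = 1])
    show "norm (Abs_ell2 (?g x)) \<le> norm x * 1" for x
      using summ[of x] by (simp add: norm_ell2_def g)
  qed (rule ell2_eqI, simp only: g, simp add: g coeff_plus coeff_scaleR sum.distrib scaleR_sum_right)+
  then show ?thesis
    by (simp add: creation_def bounded_linear_Blinfun_apply g)
qed

lemma creation_ket: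
  assumes "inj_on (\<lambda>w. v \<otimes>\<^bsub>G\<^esub> w) (carrier G)"
  shows "creation G v (ket w) = (if w \<in> carrier G then ket (v \<otimes>\<^bsub>G\<^esub> w) else 0)"
proof (rule ell2_eqI)
  fix u
  have *: "{w'. w' \<in> carrier G \<and> v \<otimes>\<^bsub>G\<^esub> w' = u} =
      (if u \<in> (\<lambda>w. v \<otimes>\<^bsub>G\<^esub> w) ` carrier G
       then {inv_into (carrier G) (\<lambda>w. v \<otimes>\<^bsub>G\<^esub> w) u} else {})"
    using assms by (auto simp: inj_on_eq_iff)
  show "coeff (creation G v (ket w)) u = coeff (if w \<in> carrier G then ket (v \<otimes>\<^bsub>G\<^esub> w) else 0) u"
    using assms by (auto simp: coeff_creation[OF assms] coeff_ket coeff_zero * inv_into_f_f)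
qed

lemma two_graph_creation_ket:
  assumes "bij \<theta>" "v \<in> carrier (two_graph \<theta>)"
  shows "creation (two_graph \<theta>) v (ket w) =
    (if w \<in> carrier (two_graph \<theta>) then ket (v \<otimes>\<^bsub>two_graph \<theta>\<^esub> w) else 0)"
  by (intro creation_ket two_graph_left_cancel assms)

definition complex_subalgebra :: "('a ell2 \<Rightarrow>\<^sub>L 'a ell2) set \<Rightarrow> bool" where
  "complex_subalgebra A \<longleftrightarrow> 0 \<in> A \<and>
     (\<forall>S\<in>A. \<forall>T\<in>A. S + T \<in> A \<and> S o\<^sub>L T \<in> A) \<and>
     (\<forall>c. \<forall>T\<in>A. cscale c o\<^sub>L T \<in> A)"

definition toeplitz_algebra :: "'a monoid \<Rightarrow> ('a ell2 \<Rightarrow>\<^sub>L 'a ell2) set" where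
  "toeplitz_algebra G = \<Inter>{A. complex_subalgebra A \<and> closed A \<and> creation G ` carrier G \<subseteq> A}"

definition isometrically_isomorphic ::
  "('a ell2 \<Rightarrow>\<^sub>L 'a ell2) set \<Rightarrow> ('b ell2 \<Rightarrow>\<^sub>L 'b ell2) set \<Rightarrow> bool" where
  "isometrically_isomorphic A B \<longleftrightarrow> (\<exists>\<phi>. bij_betw \<phi> A B \<and>
     (\<forall>S\<in>A. \<forall>T\<in>A. \<phi> (S + T) = \<phi> S + \<phi> T \<and> \<phi> (S o\<^sub>L T) = \<phi> S o\<^sub>L \<phi> T) \<and>
     (\<forall>c. \<forall>T\<in>A. \<phi> (cscale c o\<^sub>L T) = cscale c o\<^sub>L \<phi> T) \<and>
     (\<forall>T\<in>A. norm (\<phi> T) = norm T))"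

section \<open>Gelfand spaces of minimal type\<close>

definition gelfand_space ::
  "('n::finite \<times> 'm::finite \<Rightarrow> 'n \<times> 'm) \<Rightarrow> ((complex^'n) \<times> (complex^'m)) set" where
  "gelfand_space \<theta> = {(z, w). z \<in> cball 0 1 \<and> w \<in> cball 0 1 \<and>
     (\<forall>i j i' j'. \<theta> (i, j) = (i', j') \<longrightarrow> z $ i * w $ j = z $ i' * w $ j')}"

definition diagonal :: "(complex^'d) set" where
  "diagonal = {z. \<forall>i j. z $ i = z $ j}"

definition minimal_type :: "('n::finite \<times> 'm::finite \<Rightarrow> 'n \<times> 'm) \<Rightarrow> bool" where
  "minimal_type \<theta> \<longleftrightarrow> gelfand_space \<theta> =
     (cball 0 1 \<times> {0}) \<union> ({0} \<times> cball 0 1) \<union>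
     ((cball 0 1 \<inter> diagonal) \<times> (cball 0 1 \<inter> diagonal))"

section \<open>Cycle notation on the cells of the 2 by 3 rectangle\<close>

text \<open>
  The types \<^typ>\<open>2\<close> and \<^typ>\<open>3\<close> have two and three elements, and \<open>(2::2) = 0\<close>, \<open>(3::3) = 0\<close>, so
  that the elements are \<open>1, 2\<close> and \<open>1, 2, 3\<close> respectively.
\<close>

definition cell :: "nat \<Rightarrow> 2 \<times> 3" where
  "cell k = [(1, 1), (1, 2), (1, 3), (2, 1), (2, 2), (2, 3)] ! (k - 1)"

definition cell_cycle :: "nat list \<Rightarrow> 2 \<times> 3 \<Rightarrow> 2 \<times> 3" where
  "cell_cycle cs = cycle_of_list (map cell cs)"

definition cyclic_perms :: "(2 \<times> 3 \<Rightarrow> 2 \<times> 3) set" where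
  "cyclic_perms = {\<theta>. cyclic_type \<theta>}"

definition two_graph_iso :: "((2 \<times> 3 \<Rightarrow> 2 \<times> 3) \<times> (2 \<times> 3 \<Rightarrow> 2 \<times> 3)) set" where
  "two_graph_iso = {(\<theta>\<^sub>1, \<theta>\<^sub>2). \<theta>\<^sub>1 \<in> cyclic_perms \<and> \<theta>\<^sub>2 \<in> cyclic_perms \<and>
     two_graph \<theta>\<^sub>1 \<cong> two_graph \<theta>\<^sub>2}"

end

theory Submission
  imports Defs "HOL-Combinatorics.Multiset_Permutations"
begin

text \<open>
  An operator \<open>T\<close> in the Toeplitz algebra of \<open>\<F>\<^sub>n\<^sup>+ \<times>\<^sub>\<theta> \<F>\<^sub>m\<^sup>+\<close> is determined by the Fourier
  coefficients of \<open>T\<xi>\<^sub>1\<close>, and products of operators correspond to convolution of coefficients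
  (\<open>toeplitz_convolution\<close>).  Let \<open>\<phi>\<close> be an isometric isomorphism from the algebra of \<open>\<theta>1\<close> to that
  of \<open>\<theta>2\<close>.  Write \<open>p(x)\<close> for the constant coefficient of \<open>\<phi>(L\<^sub>x)\<close> and \<open>D(y, x)\<close> for its
  coefficient at \<open>y\<close>, where \<open>x\<close> and \<open>y\<close> are generators.  Comparing coefficients of degree at most two
  in the relations \<open>e\<^sub>i f\<^sub>j = f\<^sub>j\<^sub>' e\<^sub>i\<^sub>'\<close> gives quadratic equations for \<open>p\<close> and \<open>D\<close>, and \<open>D\<close> is invertible
  because a continuous derivation that vanishes on all generators is zero
  (\<open>isomorphism_linear_part\<close>).

  A point \<open>p \<noteq> 0\<close> would give a linear dependence between the columns of \<open>D\<close>, because the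
  Gelfand space is minimal.  Hence \<open>p = 0\<close>.  The degree two equations for words in the \<open>e\<^sub>i\<close> alone
  or in the \<open>f\<^sub>j\<close> alone say that the rows of \<open>D\<close> satisfy the equations of the Gelfand space.  This
  and \<open>n < m\<close> make \<open>D\<close> block diagonal, with blocks \<open>A\<close> and \<open>B\<close>, and the remaining equations say that
  \<open>A \<otimes> B\<close> intertwines the permutation matrices of \<open>\<theta>1\<close> and \<open>\<theta>2\<close> (\<open>linear_part_product\<close>).  All-ones
  vectors are, up to multiples, the only pairs \<open>(z, w)\<close> of nonzero vectors with \<open>z \<otimes> w\<close> fixed by the
  permutations, so that \<open>A\<close> and \<open>B\<close> have constant row and column sums.  Consequently \<open>A \<otimes> B\<close>
  commutes with \<open>I \<otimes> J\<close> and \<open>J \<otimes> I\<close>, where \<open>J\<close> is an all-ones matrix, and the traces of words in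
  the permutation matrix and these two matrices are invariants.  For the words used here they are
  the cardinalities called \<open>link_count\<close> below (\<open>isomorphic_imp_link_count_eq\<close>).

  Conversely, product conjugate permutations have isomorphic semigroups, and an isomorphism of
  semigroups is implemented by a unitary that carries one algebra onto the other
  (\<open>monoid_iso_imp_isometrically_isomorphic\<close>).  For \<open>(n, m) = (2, 3)\<close> it remains to inspect
  permutations of six cells.  If the Gelfand space of \<open>\<theta>\<close> is minimal, then no proper subrectangle is
  invariant under \<open>\<theta>\<close>.  Up to product conjugacy there are \<open>24\<close> permutations with this property.  Six
  link counts separate them, and \<open>14\<close> of them are cycles of length six.  Therefore isomorphism
  of the algebras, isomorphism of the semigroups, product conjugacy and equality of the six
  numbers are all equivalent for minimal Gelfand spaces
  (\<open>isomorphism_iff_link_invariants_eq\<close>), and the cyclic permutations form \<open>14\<close> classes.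
\<close>

section \<open>Convolution in Toeplitz algebras of monoids\<close>

lemma bounded_linear_coeff: "bounded_linear (\<lambda>x. coeff x i)"
proof (rule bounded_linear_intro[where K = 1])
  fix x :: "'a ell2"
  have "(\<Sum>j\<in>{i}. (cmod (coeff x j))\<^sup>2) \<le> (\<Sum>\<^sub>\<infinity>j. (cmod (coeff x j))\<^sup>2)"
    by (rule finite_sum_le_infsum) (auto intro: coeff_summable)
  then show "cmod (coeff x i) \<le> norm x * 1"
    by (simp add: norm_ell2_def real_le_rsqrt)
qed (simp_all add: coeff_plus coeff_scaleR)

lemmas continuous_on_coeff [continuous_intros] =
  bounded_linear.continuous_on[OF bounded_linear_coeff]

lemma toeplitz_algebra_induct:
  assumes "T \<in> toeplitz_algebra G" "complex_subalgebra {T. P T}" "closed {T. P T}"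
    "\<And>v. v \<in> carrier G \<Longrightarrow> P (creation G v)"
  shows "P T"
  using assms unfolding toeplitz_algebra_def by blast

lemma complex_subalgebra_toeplitz: "complex_subalgebra (toeplitz_algebra G)"
  unfolding toeplitz_algebra_def complex_subalgebra_def by blast

lemma closed_toeplitz: "closed (toeplitz_algebra G)"
  unfolding toeplitz_algebra_def by (rule closed_Inter) auto

lemma creation_in_toeplitz: "v \<in> carrier G \<Longrightarrow> creation G v \<in> toeplitz_algebra G"
  unfolding toeplitz_algebra_def by blast

definition left_cancellative :: "('a, 'b) monoid_scheme \<Rightarrow> bool" where
  "left_cancellative G \<longleftrightarrow> monoid G \<and> (\<forall>v\<in>carrier G. inj_on (\<lambda>w. v \<otimes>\<^bsub>G\<^esub> w) (carrier G))"

lemma left_cancellativeD: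
  assumes "left_cancellative G"
  shows "monoid G" and "v \<in> carrier G \<Longrightarrow> inj_on (\<lambda>w. v \<otimes>\<^bsub>G\<^esub> w) (carrier G)"
  using assms by (simp_all add: left_cancellative_def)

text \<open>
  The factorizations of \<open>u\<close> index the convolution product.  Since words in a 2-graph have a length,
  they are finite in number there.
\<close>

definition factorizations :: "('a, 'b) monoid_scheme \<Rightarrow> 'a \<Rightarrow> ('a \<times> 'a) set" where
  "factorizations G u = {(v, w). v \<in> carrier G \<and> w \<in> carrier G \<and> v \<otimes>\<^bsub>G\<^esub> w = u}"

text \<open>
  Both sides are continuous in \<open>T\<close>, and the identity holds for the generators of the algebra.
  It passes to products by associativity: both orders of summation enumerate the factorizations
  of \<open>u\<close> into three factors.
\<close>

lemma toeplitz_convolution: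
  fixes G (structure)
  assumes G: "left_cancellative G"
    and fin: "\<And>u. u \<in> carrier G \<Longrightarrow> finite (factorizations G u)"
    and T: "T \<in> toeplitz_algebra G" and u: "u \<in> carrier G"
  shows "coeff (T x) u = (\<Sum>(v, w)\<in>factorizations G u. coeff (T (ket \<one>)) v * coeff x w)"
proof -
  interpret monoid G
    by (rule left_cancellativeD(1)[OF G])
  note cancel = left_cancellativeD(2)[OF G]
  define P where "P T \<longleftrightarrow> (\<forall>x. \<forall>u\<in>carrier G.
    coeff (blinfun_apply T x) u = (\<Sum>(v, w)\<in>factorizations G u. coeff (T (ket \<one>)) v * coeff x w))" for T
  have "P T"
    using T
  proof (rule toeplitz_algebra_induct)
    have "P (S o\<^sub>L T)" if P: "P S" "P T" for S T
      unfolding P_def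
    proof (intro allI ballI)
      fix x u assume u: "u \<in> carrier G"
      have "coeff ((S o\<^sub>L T) x) u = (\<Sum>(v, w)\<in>factorizations G u. \<Sum>(w1, w2)\<in>factorizations G w.
          coeff (S (ket \<one>)) v * coeff (T (ket \<one>)) w1 * coeff x w2)"
        using P u by (auto simp: P_def sum_distrib_left factorizations_def mult.assoc intro!: sum.cong)
      also have "\<dots> = (\<Sum>((v, w), (w1, w2))\<in>(SIGMA (v, w):factorizations G u. factorizations G w).
          coeff (S (ket \<one>)) v * coeff (T (ket \<one>)) w1 * coeff x w2)"
        using fin u by (subst sum.Sigma[symmetric]) (auto simp: factorizations_def intro!: sum.cong)
      also have "\<dots> = (\<Sum>((y, w2), (v, w1))\<in>(SIGMA (y, w2):factorizations G u. factorizations G y).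
          coeff (S (ket \<one>)) v * coeff (T (ket \<one>)) w1 * coeff x w2)"
        by (rule sum.reindex_bij_witness[where
              j = "\<lambda>((v, w), (w1, w2)). ((v \<otimes> w1, w2), (v, w1))" and
              i = "\<lambda>((y, w2), (v, w1)). ((v, w1 \<otimes> w2), (w1, w2))"])
          (auto simp: factorizations_def m_assoc)
      also have "\<dots> = (\<Sum>(y, w2)\<in>factorizations G u. \<Sum>(v, w1)\<in>factorizations G y.
          coeff (S (ket \<one>)) v * coeff (T (ket \<one>)) w1 * coeff x w2)"
        using fin u by (subst sum.Sigma[symmetric]) (auto simp: factorizations_def intro!: sum.cong)
      also have "\<dots> = (\<Sum>(y, w2)\<in>factorizations G u. coeff ((S o\<^sub>L T) (ket \<one>)) y * coeff x w2)"
        using P by (auto simp: P_def sum_distrib_right factorizations_def intro!: sum.cong)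
      finally show "coeff ((S o\<^sub>L T) x) u =
          (\<Sum>(y, w2)\<in>factorizations G u. coeff ((S o\<^sub>L T) (ket \<one>)) y * coeff x w2)" .
    qed
    then show "complex_subalgebra {T. P T}"
      unfolding complex_subalgebra_def
      by (auto simp: P_def coeff_zero coeff_cscale blinfun.add_left coeff_plus algebra_simps
          sum.distrib sum_distrib_left case_prod_unfold intro!: sum.cong)
    have "{T. P T} = (\<Inter>x. \<Inter>u\<in>carrier G. {T. coeff (blinfun_apply T x) u =
        (\<Sum>(v, w)\<in>factorizations G u. coeff (T (ket \<one>)) v * coeff x w)})"
      by (auto simp: P_def)
    also have "closed \<dots>"
      unfolding case_prod_unfold
      by (intro closed_INT ballI closed_Collect_eq continuous_intros)
    finally show "closed {T. P T}" .
  next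
    fix g assume g: "g \<in> carrier G"
    show "P (creation G g)"
      unfolding P_def
    proof (intro allI ballI)
      fix x u assume u: "u \<in> carrier G"
      have "(\<Sum>(v, w)\<in>factorizations G u. coeff (creation G g (ket \<one>)) v * coeff x w)
          = (\<Sum>(v, w)\<in>factorizations G u. if v = g then coeff x w else 0)"
        using g by (auto simp: creation_ket[OF cancel] coeff_ket intro!: sum.cong)
      also have "\<dots> = (\<Sum>(v, w) | (v, w) \<in> factorizations G u \<and> v = g. coeff x w)"
        by (rule sum.mono_neutral_cong_right[OF fin[OF u]]) (auto split: if_splits)
      also have "\<dots> = (\<Sum>w | w \<in> carrier G \<and> g \<otimes> w = u. coeff x w)"
        by (rule sum.reindex_bij_witness[where j = snd and i = "Pair g"])
          (use g in \<open>auto simp: factorizations_def\<close>)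
      finally show "coeff (creation G g x) u =
          (\<Sum>(v, w)\<in>factorizations G u. coeff (creation G g (ket \<one>)) v * coeff x w)"
        by (simp add: coeff_creation[OF cancel[OF g]])
    qed
  qed
  then show ?thesis
    using u by (simp add: P_def)
qed

lemma creation_mult:
  assumes G: "left_cancellative G" and uv: "u \<in> carrier G" "v \<in> carrier G"
  shows "creation G (u \<otimes>\<^bsub>G\<^esub> v) = creation G u o\<^sub>L creation G v"
proof (rule blinfun_eqI, rule ell2_eqI)
  interpret monoid G
    by (rule left_cancellativeD(1)[OF G])
  note cancel = left_cancellativeD(2)[OF G]
  fix x U
  have fin: "finite {W. W \<in> carrier G \<and> v \<otimes>\<^bsub>G\<^esub> W = V}" if "v \<in> carrier G" for v V
    by (rule inj_on_finite[where f = "\<lambda>W. v \<otimes>\<^bsub>G\<^esub> W" and B = "{V}"])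
      (use cancel[OF that] in \<open>auto simp: inj_on_def\<close>)
  have "coeff ((creation G u o\<^sub>L creation G v) x) U =
      (\<Sum>V | V \<in> carrier G \<and> u \<otimes>\<^bsub>G\<^esub> V = U. \<Sum>W | W \<in> carrier G \<and> v \<otimes>\<^bsub>G\<^esub> W = V. coeff x W)"
    using uv by (simp add: coeff_creation cancel)
  also have "\<dots> = sum (\<lambda>(V, W). coeff x W) (SIGMA V:{V \<in> carrier G. u \<otimes>\<^bsub>G\<^esub> V = U}.
      {W \<in> carrier G. v \<otimes>\<^bsub>G\<^esub> W = V})"
    by (rule sum.Sigma) (use fin uv in auto)
  also have "\<dots> = (\<Sum>W | W \<in> carrier G \<and> (u \<otimes>\<^bsub>G\<^esub> v) \<otimes>\<^bsub>G\<^esub> W = U. coeff x W)"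
    by (rule sum.reindex_bij_witness[where j = snd and i = "\<lambda>W. (v \<otimes>\<^bsub>G\<^esub> W, W)"])
      (use uv in \<open>auto simp: m_assoc\<close>)
  finally show "coeff (creation G (u \<otimes>\<^bsub>G\<^esub> v) x) U = coeff ((creation G u o\<^sub>L creation G v) x) U"
    using uv by (simp add: coeff_creation cancel)
qed

section \<open>Words of length at most two in a single vertex 2-graph\<close>

abbreviation cls :: "('n \<times> 'm \<Rightarrow> 'n \<times> 'm) \<Rightarrow> ('n + 'm) list \<Rightarrow> ('n + 'm) list set" where
  "cls \<theta> u \<equiv> {w. word_cong \<theta> u w}"

lemma cls_eq_iff: "cls \<theta> u = cls \<theta> v \<longleftrightarrow> word_cong \<theta> u v"
  by (blast intro: word_cong.refl word_cong.sym word_cong.trans)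

lemma two_graph_one: "\<one>\<^bsub>two_graph \<theta>\<^esub> = cls \<theta> []"
  by (simp add: two_graph_def)

lemma cls_in_carrier: "cls \<theta> u \<in> carrier (two_graph \<theta>)"
  by (simp add: two_graph_carrier)

lemma monoid_two_graph: "monoid (two_graph \<theta>)"
  by unfold_locales (auto simp: two_graph_carrier two_graph_mult two_graph_one)

lemma left_cancellative_two_graph: "bij \<theta> \<Longrightarrow> left_cancellative (two_graph \<theta>)"
  by (simp add: left_cancellative_def monoid_two_graph two_graph_left_cancel)

lemma word_cong_length: "word_cong \<theta> u v \<Longrightarrow> length u = length v"
  by (induction rule: word_cong.induct) auto

lemma factorizations_two_graph:
  "factorizations (two_graph \<theta>) (cls \<theta> u) =
    (\<Union>w\<in>cls \<theta> u. (\<lambda>k. (cls \<theta> (take k w), cls \<theta> (drop k w))) ` {..length w})"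
    (is "?F = ?R")
proof
  show "?F \<subseteq> ?R"
  proof
    fix p assume "p \<in> ?F"
    then obtain v w where p: "p = (cls \<theta> v, cls \<theta> w)" and "cls \<theta> (v @ w) = cls \<theta> u"
      unfolding factorizations_def two_graph_carrier by (auto simp: two_graph_mult)
    then have "word_cong \<theta> (v @ w) u"
      by (simp add: cls_eq_iff)
    with p show "p \<in> ?R"
      by (auto intro!: bexI[of _ "v @ w"] image_eqI[of _ _ "length v"] intro: word_cong.sym)
  qed
  show "?R \<subseteq> ?F"
  proof
    fix p assume "p \<in> ?R"
    then obtain w k where w: "word_cong \<theta> u w" and p: "p = (cls \<theta> (take k w), cls \<theta> (drop k w))"
      by auto
    from w have "cls \<theta> u = cls \<theta> w"
      by (simp only: cls_eq_iff)
    then show "p \<in> ?F"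
      by (simp add: p factorizations_def cls_in_carrier two_graph_mult)
  qed
qed

lemma finite_cls: "finite (cls \<theta> (u :: ('n::finite + 'm::finite) list))"
proof (rule finite_subset)
  show "cls \<theta> u \<subseteq> {w. set w \<subseteq> UNIV \<and> length w = length u}"
    by (auto dest: word_cong_length)
qed (rule finite_lists_length_eq, simp)

lemma finite_factorizations:
  "U \<in> carrier (two_graph \<theta>) \<Longrightarrow> finite (factorizations (two_graph \<theta>) U)"
  for \<theta> :: "'n::finite \<times> 'm::finite \<Rightarrow> 'n \<times> 'm"
  by (auto simp: two_graph_carrier factorizations_two_graph finite_cls)

lemma word_cong_Nil: "word_cong \<theta> [] w \<longleftrightarrow> w = []"
  by (auto dest: word_cong_length intro: word_cong.refl)

lemma word_cong_letter:
  assumes "bij \<theta>"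
  shows "word_cong \<theta> [x] w \<longleftrightarrow> w = [x]"
proof
  assume w: "word_cong \<theta> [x] w"
  then obtain y where y: "w = [y]"
    using word_cong_length[OF w] by (cases w) auto
  have "act \<theta> x ([], []) = act \<theta> y ([], [])"
    using word_cong_act[OF assms w, of "([], [])"] y by simp
  then show "w = [x]"
    using y by (cases x; cases y) auto
qed (simp add: word_cong.refl)

text \<open>
  Congruent words act in the same way on normal forms, and the action of a word of length two on
  the empty normal form already determines the word up to the defining relation.
\<close>

lemma word_cong_two:
  assumes "bij \<theta>"
  shows "cls \<theta> [Inl i, Inl k] = {[Inl i, Inl k]}" "cls \<theta> [Inr j, Inr l] = {[Inr j, Inr l]}"
    "\<theta> (i, j) = (i', j') \<Longrightarrow> cls \<theta> [Inl i, Inr j] = {[Inl i, Inr j], [Inr j', Inl i']}"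
proof -
  have len: "\<exists>a b. w = [a, b]" if "word_cong \<theta> [x, y] w" for x y w
    using word_cong_length[OF that, symmetric] by (auto simp: length_Suc_conv)
  note act = word_cong_act[OF assms, of _ _ "([], [])"]
  have inv: "inv_into UNIV \<theta> q = p \<longleftrightarrow> \<theta> p = q" for p q
    using assms by (metis bij_inv_eq_iff)
  have 1: "w = [Inl i, Inl k]" if w: "word_cong \<theta> [Inl i, Inl k] w" for i k w
  proof -
    obtain a b where "w = [a, b]" using len[OF w] by blast
    then show ?thesis 
      using act[OF w] by (cases a; cases b) (auto simp: Let_def split: prod.splits)
  qed
  show "cls \<theta> [Inl i, Inl k] = {[Inl i, Inl k]}" 
    using 1 word_cong.refl by blast
  have 2: "w = [Inr j, Inr l]" if w: "word_cong \<theta> [Inr j, Inr l] w" for j l w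
  proof -
    obtain a b where "w = [a, b]" using len[OF w] by blast
    then show ?thesis 
      using act[OF w] by (cases a; cases b) (auto simp: Let_def split: prod.splits)
  qed
  show "cls \<theta> [Inr j, Inr l] = {[Inr j, Inr l]}"
    using 2 word_cong.refl by blast
  assume th: "\<theta> (i, j) = (i', j')"
  have 3: "w = [Inl i, Inr j] \<or> w = [Inr j', Inl i']" if w: "word_cong \<theta> [Inl i, Inr j] w" for w
  proof -
    obtain a b where "w = [a, b]" using len[OF w] by blast
    then show ?thesis 
      using act[OF w] th
      by (cases a; cases b) (auto simp: Let_def inv split: prod.splits)
  qed
  have "word_cong \<theta> [Inl i, Inr j] [Inr j', Inl i']"
    using word_cong.commute[of \<theta> i j i' j' "[]" "[]"] th by simp
  then show "cls \<theta> [Inl i, Inr j] = {[Inl i, Inr j], [Inr j', Inl i']}"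
    using 3 word_cong.refl by blast
qed

section \<open>Fourier coefficients of operators in the Toeplitz algebra\<close>

text \<open>
  The Fourier coefficient of \<open>T\<close> at the element of the semigroup that \<open>w\<close> represents.
\<close>

definition symbol :: "('n \<times> 'm \<Rightarrow> 'n \<times> 'm) \<Rightarrow> (('n + 'm) list set ell2 \<Rightarrow>\<^sub>L ('n + 'm) list set ell2)
    \<Rightarrow> ('n + 'm) list \<Rightarrow> complex" where
  "symbol \<theta> T w = coeff (T (ket (cls \<theta> []))) (cls \<theta> w)"

lemma symbol_linear:
  "symbol \<theta> 0 w = 0" "symbol \<theta> (S + T) w = symbol \<theta> S w + symbol \<theta> T w"
  "symbol \<theta> (cscale c o\<^sub>L T) w = c * symbol \<theta> T w"
  by (simp_all add: symbol_def blinfun.add_left coeff_plus coeff_zero coeff_cscale)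

lemma continuous_on_symbol [continuous_intros]:
  "continuous_on A f \<Longrightarrow> continuous_on A (\<lambda>T. symbol \<theta> (f T) w)"
  unfolding symbol_def by (intro continuous_intros)

lemma symbol_creation:
  assumes "bij \<theta>"
  shows "symbol \<theta> (creation (two_graph \<theta>) (cls \<theta> u)) w = (if word_cong \<theta> w u then 1 else 0)"
  using assms cls_in_carrier[of \<theta> u] cls_in_carrier[of \<theta> "[]"]
  by (simp add: symbol_def two_graph_creation_ket two_graph_mult coeff_ket cls_eq_iff)

lemma symbol_compose:
  fixes \<theta> :: "'n::finite \<times> 'm::finite \<Rightarrow> 'n \<times> 'm"
  assumes "bij \<theta>" "S \<in> toeplitz_algebra (two_graph \<theta>)"
  shows "symbol \<theta> (S o\<^sub>L T) w = (\<Sum>(V, W)\<in>factorizations (two_graph \<theta>) (cls \<theta> w).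
    coeff (S (ket (cls \<theta> []))) V * coeff (T (ket (cls \<theta> []))) W)"
  using toeplitz_convolution[OF left_cancellative_two_graph[OF assms(1)] finite_factorizations
      assms(2) cls_in_carrier]
  by (simp add: symbol_def two_graph_one)

lemma cls_neq:
  "length u \<noteq> length v \<Longrightarrow> cls \<theta> u \<noteq> cls \<theta> v"
  by (auto simp: cls_eq_iff dest: word_cong_length)

lemma cls_letter_eq: "bij \<theta> \<Longrightarrow> cls \<theta> [x] = cls \<theta> [y] \<longleftrightarrow> x = y"
  by (auto simp: cls_eq_iff word_cong_letter)

lemma symbol_compose_low:
  fixes \<theta> :: "'n::finite \<times> 'm::finite \<Rightarrow> 'n \<times> 'm"
  assumes "bij \<theta>" "S \<in> toeplitz_algebra (two_graph \<theta>)"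
  shows "symbol \<theta> (S o\<^sub>L T) [] = symbol \<theta> S [] * symbol \<theta> T []"
    and "symbol \<theta> (S o\<^sub>L T) [x] = symbol \<theta> S [x] * symbol \<theta> T [] + symbol \<theta> S [] * symbol \<theta> T [x]"
proof -
  have "cls \<theta> [] = {[]}"
    by (simp add: word_cong_Nil)
  then have "factorizations (two_graph \<theta>) (cls \<theta> []) = {(cls \<theta> [], cls \<theta> [])}"
    by (subst factorizations_two_graph) simp
  then show "symbol \<theta> (S o\<^sub>L T) [] = symbol \<theta> S [] * symbol \<theta> T []"
    by (simp add: symbol_compose[OF assms]) (simp add: symbol_def)
  have "cls \<theta> [x] = {[x]}"
    by (simp add: word_cong_letter[OF assms(1)])
  then have "factorizations (two_graph \<theta>) (cls \<theta> [x]) = {(cls \<theta> [x], cls \<theta> []), (cls \<theta> [], cls \<theta> [x])}"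
    by (subst factorizations_two_graph) (auto simp: atMost_Suc)
  then show "symbol \<theta> (S o\<^sub>L T) [x] = symbol \<theta> S [x] * symbol \<theta> T [] + symbol \<theta> S [] * symbol \<theta> T [x]"
    using cls_neq[of "[x]" "[]" \<theta>]
    by (simp add: symbol_compose[OF assms]) (simp add: symbol_def)
qed

text \<open>
  If both constant coefficients vanish, then only the factorizations into two generators
  contribute in degree two.  They correspond to the words in the congruence class.
\<close>

lemma symbol_compose_two:
  fixes \<theta> :: "'n::finite \<times> 'm::finite \<Rightarrow> 'n \<times> 'm"
  assumes "bij \<theta>" "S \<in> toeplitz_algebra (two_graph \<theta>)" "symbol \<theta> S [] = 0" "symbol \<theta> T [] = 0"
  shows "symbol \<theta> (S o\<^sub>L T) [a, b] =
    (\<Sum>w\<in>cls \<theta> [a, b]. symbol \<theta> S [w ! 0] * symbol \<theta> T [w ! 1])"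
proof -
  let ?m = "\<lambda>w. (cls \<theta> [w ! 0], cls \<theta> [w ! 1])"
  let ?f = "\<lambda>(V, W). coeff (S (ket (cls \<theta> []))) V * coeff (T (ket (cls \<theta> []))) W"
  have F: "factorizations (two_graph \<theta>) (cls \<theta> [a, b]) =
      {(cls \<theta> [], cls \<theta> [a, b]), (cls \<theta> [a, b], cls \<theta> [])} \<union> ?m ` cls \<theta> [a, b]" (is "?F = ?R")
  proof -
    have "(\<lambda>k. (cls \<theta> (take k w), cls \<theta> (drop k w))) ` {..length w} =
        {(cls \<theta> [], cls \<theta> [a, b]), (cls \<theta> [a, b], cls \<theta> [])} \<union> {?m w}" if w: "w \<in> cls \<theta> [a, b]" for w
    proof -
      obtain c d where cd: "w = [c, d]"
        using w word_cong_length[of \<theta> "[a, b]" w, symmetric] by (auto simp: length_Suc_conv)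
      have "cls \<theta> [a, b] = cls \<theta> w"
        using w by (simp only: cls_eq_iff mem_Collect_eq)
      then show ?thesis
        by (auto simp: cd atMost_Suc)
    qed
    then have "?F = (\<Union>w\<in>cls \<theta> [a, b].
        {(cls \<theta> [], cls \<theta> [a, b]), (cls \<theta> [a, b], cls \<theta> [])} \<union> {?m w})"
      unfolding factorizations_two_graph by (rule SUP_cong[OF HOL.refl])
    also have "\<dots> = ?R"
      using word_cong.refl[of \<theta> "[a, b]"] by blast
    finally show ?thesis .
  qed
  have inj: "inj_on ?m (cls \<theta> [a, b])"
  proof (rule inj_onI)
    fix v w assume v: "v \<in> cls \<theta> [a, b]" and w: "w \<in> cls \<theta> [a, b]" and eq: "?m v = ?m w"
    have "length v = 2" "length w = 2"
      using word_cong_length[of \<theta> "[a, b]" v] word_cong_length[of \<theta> "[a, b]" w] v w by simp_all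
    moreover have "v ! 0 = w ! 0" "v ! 1 = w ! 1"
      using eq by (simp_all only: prod.inject cls_letter_eq[OF assms(1)])
    ultimately show "v = w"
      by (auto simp: list_eq_iff_nth_eq less_2_cases_iff)
  qed
  have "symbol \<theta> (S o\<^sub>L T) [a, b] = sum ?f (?m ` cls \<theta> [a, b])"
    unfolding symbol_compose[OF assms(1,2)] F
    by (rule sum.mono_neutral_right)
      (use assms(3,4) in \<open>auto simp: finite_cls symbol_def\<close>)
  also have "\<dots> = (\<Sum>w\<in>cls \<theta> [a, b]. symbol \<theta> S [w ! 0] * symbol \<theta> T [w ! 1])"
    by (subst sum.reindex[OF inj]) (simp add: symbol_def)
  finally show ?thesis .
qed

lemma creation_append:
  assumes "bij \<theta>"
  shows "creation (two_graph \<theta>) (cls \<theta> (u @ v)) =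
    creation (two_graph \<theta>) (cls \<theta> u) o\<^sub>L creation (two_graph \<theta>) (cls \<theta> v)"
  using creation_mult[OF left_cancellative_two_graph[OF assms] cls_in_carrier cls_in_carrier]
  by (simp add: two_graph_mult)

section \<open>The linear part of an isomorphism\<close>

lemma isomorphism_continuous_on:
  assumes "\<And>S T. S \<in> A \<Longrightarrow> T \<in> A \<Longrightarrow> \<phi> (S + T) = \<phi> S + \<phi> T"
    and "\<And>T. T \<in> A \<Longrightarrow> norm (\<phi> T) = norm T" and "complex_subalgebra A"
  shows "continuous_on A (\<phi> :: ('a ell2 \<Rightarrow>\<^sub>L 'a ell2) \<Rightarrow> ('b ell2 \<Rightarrow>\<^sub>L 'b ell2))"
proof -
  have neg: "- T \<in> A" if "T \<in> A" for T
  proof -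
    have "cscale (-1) o\<^sub>L T = - T"
      by (rule blinfun_eqI, rule ell2_eqI) (simp add: coeff_cscale blinfun.minus_left coeff_uminus)
    then show ?thesis
      using assms(3) that unfolding complex_subalgebra_def by metis
  qed
  have "dist (\<phi> S) (\<phi> T) = dist S T" if "S \<in> A" "T \<in> A" for S T
  proof -
    have "S - T \<in> A"
      using assms(3) neg[OF that(2)] that(1) unfolding complex_subalgebra_def
      by (metis add_uminus_conv_diff)
    then have "\<phi> S = \<phi> (S - T) + \<phi> T"
      using assms(1)[of "S - T" T] that by simp
    then show ?thesis
      using assms(2)[OF \<open>S - T \<in> A\<close>] by (simp add: dist_norm)
  qed
  then show ?thesis
    unfolding continuous_on_iff by metis
qed

text \<open>
  The first, second and fourth conclusions compare the coefficients of degree zero, one and two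
  in the images of \<open>L\<^sub>e L\<^sub>f = L\<^sub>f\<^sub>' L\<^sub>e\<^sub>'\<close>.  For the third one, the functional
  \<open>T \<mapsto> \<Sum>y. v y * symbol \<theta>2 T [y]\<close> is a point derivation at the vacuum character of the second
  algebra.  Its pullback along \<open>\<phi>\<close> is a continuous point derivation at the character \<open>p\<close>.  If the
  pullback vanishes on the generators, then it vanishes on the whole algebra, and so does the
  functional, because \<open>\<phi>\<close> is onto.
\<close>

lemma isomorphism_linear_part:
  fixes \<theta>1 \<theta>2 :: "'n::finite \<times> 'm::finite \<Rightarrow> 'n \<times> 'm"
  assumes bij: "bij \<theta>1" "bij \<theta>2"
    and iso: "isometrically_isomorphic (toeplitz_algebra (two_graph \<theta>1)) (toeplitz_algebra (two_graph \<theta>2))"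
  obtains p :: "'n + 'm \<Rightarrow> complex" and D :: "'n + 'm \<Rightarrow> 'n + 'm \<Rightarrow> complex" where
    "\<And>i j i' j'. \<theta>1 (i, j) = (i', j') \<Longrightarrow> p (Inl i) * p (Inr j) = p (Inl i') * p (Inr j')"
    "\<And>i j i' j' y. \<theta>1 (i, j) = (i', j') \<Longrightarrow>
      D y (Inl i) * p (Inr j) + p (Inl i) * D y (Inr j) =
      D y (Inl i') * p (Inr j') + p (Inl i') * D y (Inr j')"
    "\<And>v. (\<And>x. (\<Sum>y\<in>UNIV. v y * D y x) = 0) \<Longrightarrow> v = (\<lambda>_. 0)"
    "\<And>i j i' j' a b. (\<And>x. p x = 0) \<Longrightarrow> \<theta>1 (i, j) = (i', j') \<Longrightarrow>
      (\<Sum>w\<in>cls \<theta>2 [a, b]. D (w ! 0) (Inl i) * D (w ! 1) (Inr j)) =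
      (\<Sum>w\<in>cls \<theta>2 [a, b]. D (w ! 0) (Inr j') * D (w ! 1) (Inl i'))"
proof -
  define A1 where "A1 = toeplitz_algebra (two_graph \<theta>1)"
  define A2 where "A2 = toeplitz_algebra (two_graph \<theta>2)"
  note sub1 = complex_subalgebra_toeplitz[of "two_graph \<theta>1", folded A1_def]
  obtain \<phi> where \<phi>: "bij_betw \<phi> A1 A2"
    and add: "\<And>S T. S \<in> A1 \<Longrightarrow> T \<in> A1 \<Longrightarrow> \<phi> (S + T) = \<phi> S + \<phi> T"
    and mult: "\<And>S T. S \<in> A1 \<Longrightarrow> T \<in> A1 \<Longrightarrow> \<phi> (S o\<^sub>L T) = \<phi> S o\<^sub>L \<phi> T"
    and scale: "\<And>c T. T \<in> A1 \<Longrightarrow> \<phi> (cscale c o\<^sub>L T) = cscale c o\<^sub>L \<phi> T"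
    and norm: "\<And>T. T \<in> A1 \<Longrightarrow> norm (\<phi> T) = norm T"
    using iso unfolding isometrically_isomorphic_def A1_def A2_def by blast
  have cont: "continuous_on A1 \<phi>"
    using add norm sub1 by (rule isomorphism_continuous_on)
  have in2: "\<phi> T \<in> A2" if "T \<in> A1" for T
    using \<phi> that by (auto simp: bij_betw_def)
  define L where "L u = creation (two_graph \<theta>1) (cls \<theta>1 u)" for u
  have L_in: "L u \<in> A1" for u
    unfolding L_def A1_def by (intro creation_in_toeplitz cls_in_carrier)
  have L_append: "L (u @ v) = L u o\<^sub>L L v" for u v
    unfolding L_def by (rule creation_append[OF bij(1)])
  define s where "s T w = symbol \<theta>2 (\<phi> T) w" for T w
  have s_add: "s (S + T) w = s S w + s T w" if "S \<in> A1" "T \<in> A1" for S T w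
    using that by (simp add: s_def add symbol_linear)
  have s_scale: "s (cscale c o\<^sub>L T) w = c * s T w" if "T \<in> A1" for c T w
    using that by (simp add: s_def scale symbol_linear)
  have s_Nil: "s (S o\<^sub>L T) [] = s S [] * s T []" if "S \<in> A1" "T \<in> A1" for S T
    using that in2 by (simp add: s_def mult symbol_compose_low[OF bij(2)] A2_def)
  have s_letter: "s (S o\<^sub>L T) [x] = s S [x] * s T [] + s S [] * s T [x]"
    if "S \<in> A1" "T \<in> A1" for S T x
    using that in2 by (simp add: s_def mult symbol_compose_low[OF bij(2)] A2_def)
  have s_two: "s (S o\<^sub>L T) [a, b] = (\<Sum>w\<in>cls \<theta>2 [a, b]. s S [w ! 0] * s T [w ! 1])"
    if "S \<in> A1" "T \<in> A1" "s S [] = 0" "s T [] = 0" for S T a b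
    using that in2 by (simp add: s_def mult symbol_compose_two[OF bij(2)] A2_def)
  define p where "p x = s (L [x]) []" for x
  define D where "D y x = s (L [x]) [y]" for y x
  have rel: "L [Inl i] o\<^sub>L L [Inr j] = L [Inr j'] o\<^sub>L L [Inl i']" if "\<theta>1 (i, j) = (i', j')" for i j i' j'
  proof -
    have "word_cong \<theta>1 [Inl i, Inr j] [Inr j', Inl i']"
      using word_cong.commute[of \<theta>1 i j i' j' "[]" "[]"] that by simp
    then have "cls \<theta>1 [Inl i, Inr j] = cls \<theta>1 [Inr j', Inl i']"
      by (simp only: cls_eq_iff)
    then have "L [Inl i, Inr j] = L [Inr j', Inl i']"
      by (simp only: L_def)
    then show ?thesis
      using L_append[of "[Inl i]" "[Inr j]"] L_append[of "[Inr j']" "[Inl i']"] by simp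
  qed
  show thesis
  proof (rule that)
    fix i j i' j' assume "\<theta>1 (i, j) = (i', j')"
    note rel = rel[OF this]
    show "p (Inl i) * p (Inr j) = p (Inl i') * p (Inr j')"
      using arg_cong[OF rel, of "\<lambda>T. s T []"] L_in by (simp add: s_Nil p_def)
    show "D y (Inl i) * p (Inr j) + p (Inl i) * D y (Inr j) =
        D y (Inl i') * p (Inr j') + p (Inl i') * D y (Inr j')" for y
      using arg_cong[OF rel, of "\<lambda>T. s T [y]"] L_in by (simp add: s_letter p_def D_def)
    show "(\<Sum>w\<in>cls \<theta>2 [a, b]. D (w ! 0) (Inl i) * D (w ! 1) (Inr j)) =
        (\<Sum>w\<in>cls \<theta>2 [a, b]. D (w ! 0) (Inr j') * D (w ! 1) (Inl i'))" if "\<And>x. p x = 0" for a b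
      using arg_cong[OF rel, of "\<lambda>T. s T [a, b]"] L_in that by (simp add: s_two D_def p_def)
  next
    fix v assume v: "\<And>x. (\<Sum>y\<in>UNIV. v y * D y x) = 0"
    define \<Lambda> where "\<Lambda> T = (\<Sum>y\<in>UNIV. v y * s T [y])" for T
    have \<Lambda>_mult: "\<Lambda> (S o\<^sub>L T) = \<Lambda> S * s T [] + s S [] * \<Lambda> T" if "S \<in> A1" "T \<in> A1" for S T
      using that by (simp add: \<Lambda>_def s_letter algebra_simps sum.distrib sum_distrib_left)
    \<comment> \<open>For the idempotent \<open>L []\<close> the value of the character is \<open>0\<close> or \<open>1\<close>, so \<open>\<Lambda> = 2 p \<Lambda>\<close> forces \<open>\<Lambda> = 0\<close>.\<close>
    have \<Lambda>_L: "\<Lambda> (L u) = 0" for u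
    proof (induction u)
      case Nil
      have "L [] = L [] o\<^sub>L L []"
        using L_append[of "[]" "[]"] by simp
      then have *: "s (L []) [] = s (L []) [] * s (L []) []"
        and **: "\<Lambda> (L []) = 2 * s (L []) [] * \<Lambda> (L [])"
        using s_Nil[OF L_in L_in, of "[]" "[]"] \<Lambda>_mult[OF L_in L_in, of "[]" "[]"] by simp_all
      have "s (L []) [] = 0 \<or> s (L []) [] = 1"
        using * by (metis mult_cancel_right2)
      then show ?case
        using ** by auto
    next
      case (Cons x u)
      have "\<Lambda> (L [x]) = 0"
        using v[of x] by (simp add: \<Lambda>_def D_def)
      then show ?case
        using L_append[of "[x]" u] Cons by (simp add: \<Lambda>_mult L_in)
    qed
    have \<Lambda>_A1: "T \<in> A1 \<and> \<Lambda> T = 0" if "T \<in> A1" for T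
      using that[unfolded A1_def]
    proof (rule toeplitz_algebra_induct)
      show "complex_subalgebra {T. T \<in> A1 \<and> \<Lambda> T = 0}"
      proof -
        have "\<Lambda> (S + T) = \<Lambda> S + \<Lambda> T" if "S \<in> A1" "T \<in> A1" for S T
          using that by (simp add: \<Lambda>_def s_add algebra_simps sum.distrib)
        moreover have "\<Lambda> (cscale c o\<^sub>L T) = c * \<Lambda> T" if "T \<in> A1" for c T
          using that by (simp add: \<Lambda>_def s_scale sum_distrib_left mult.left_commute)
        moreover have "\<Lambda> 0 = 0"
          using s_add[of 0 0] sub1 by (simp add: \<Lambda>_def complex_subalgebra_def)
        ultimately show ?thesis
          using sub1 by (simp add: complex_subalgebra_def \<Lambda>_mult)
      qed
      have "continuous_on A1 \<Lambda>"
        unfolding \<Lambda>_def s_def by (intro continuous_intros cont)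
      then show "closed {T. T \<in> A1 \<and> \<Lambda> T = 0}"
        by (rule continuous_closed_preimage_constant) (simp add: A1_def closed_toeplitz)
      show "creation (two_graph \<theta>1) V \<in> A1 \<and> \<Lambda> (creation (two_graph \<theta>1) V) = 0"
        if "V \<in> carrier (two_graph \<theta>1)" for V
        using that L_in \<Lambda>_L by (auto simp: two_graph_carrier L_def)
    qed
    show "v = (\<lambda>_. 0)"
    proof
      fix x
      have "creation (two_graph \<theta>2) (cls \<theta>2 [x]) \<in> A2"
        unfolding A2_def by (intro creation_in_toeplitz cls_in_carrier)
      then obtain T where T: "T \<in> A1" "\<phi> T = creation (two_graph \<theta>2) (cls \<theta>2 [x])"
        using \<phi> by (metis bij_betw_def imageE)
      have "\<Lambda> T = (\<Sum>y\<in>UNIV. if y = x then v y else 0)"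
        unfolding \<Lambda>_def s_def T(2)
        by (rule sum.cong) (auto simp: symbol_creation[OF bij(2)] word_cong_letter[OF bij(2)])
      then show "v x = 0"
        using \<Lambda>_A1[OF T(1)] by simp
    qed
  qed
qed

section \<open>Minimal Gelfand spaces force product form\<close>

text \<open>
  Nonzero multiples of \<open>z\<close> and \<open>w\<close> solve the same equations, so that both vectors can be scaled
  into the unit balls.
\<close>

lemma minimal_type_products:
  fixes \<theta> :: "'n::finite \<times> 'm::finite \<Rightarrow> 'n \<times> 'm" and z :: "'n \<Rightarrow> complex" and w :: "'m \<Rightarrow> complex"
  assumes "minimal_type \<theta>"
    and rel: "\<And>i j i' j'. \<theta> (i, j) = (i', j') \<Longrightarrow> z i * w j = z i' * w j'"
  shows "(\<forall>i. z i = 0) \<or> (\<forall>j. w j = 0) \<or> ((\<forall>i i'. z i = z i') \<and> (\<forall>j j'. w j = w j'))"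
proof -
  define Z :: "complex^'n" where "Z = (\<chi> i. z i)"
  define W :: "complex^'m" where "W = (\<chi> j. w j)"
  define r where "r = inverse (1 + norm Z)"
  define s where "s = inverse (1 + norm W)"
  have pos: "0 < 1 + norm Z" "0 < 1 + norm W"
    by (simp_all add: add_pos_nonneg)
  have rs: "r \<noteq> 0" "s \<noteq> 0"
    using pos by (simp_all add: r_def s_def)
  have "r *\<^sub>R Z \<in> cball 0 1" "s *\<^sub>R W \<in> cball 0 1"
    using pos by (simp_all add: r_def s_def field_simps)
  moreover have "(r *\<^sub>R Z) $ i * (s *\<^sub>R W) $ j = (r *\<^sub>R Z) $ i' * (s *\<^sub>R W) $ j'"
    if "\<theta> (i, j) = (i', j')" for i j i' j'
    using rel[OF that] by (simp add: Z_def W_def)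
  ultimately have "(r *\<^sub>R Z, s *\<^sub>R W) \<in> gelfand_space \<theta>"
    unfolding gelfand_space_def by blast
  then have "r *\<^sub>R Z = 0 \<or> s *\<^sub>R W = 0 \<or> r *\<^sub>R Z \<in> diagonal \<and> s *\<^sub>R W \<in> diagonal"
    using assms(1) unfolding minimal_type_def by blast
  then show ?thesis
    using rs by (auto simp: Z_def W_def diagonal_def vec_eq_iff)
qed

lemma kernel_nontrivial:
  fixes N :: "complex^'m^'n"
  assumes "CARD('n::finite) < CARD('m::finite)"
  obtains w where "w \<noteq> 0" "N *v w = 0"
proof (rule ccontr)
  assume "\<not> thesis"
  with that have inj: "inj ((*v) N)"
    by (metis vec.inj_iff_eq_0 matrix_vector_mul_linear_gen)
  have "vec.dim (range ((*v) N)) = vec.dim (UNIV :: (complex^'m) set)"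
    using inj by (intro vec.dim_image_eq[OF matrix_vector_mul_linear_gen]) (auto intro: inj_on_subset)
  then have "CARD('m) = vec.dim (range ((*v) N))"
    by (simp only: vec_dim_card)
  also have "\<dots> \<le> CARD('n)"
    using vec.dim_subset[of "range ((*v) N)" UNIV] by (simp only: vec_dim_card subset_UNIV)
  finally show False
    using assms by simp
qed

text \<open>
  Suppose that all three subspaces are proper.  Two of them do not cover the space, so that there
  are \<open>u\<close> outside the first two and \<open>c\<close> outside the third.  As \<open>u\<close> lies in the third one, the line
  \<open>c + t u\<close> avoids it.  This line then meets one of the first two subspaces twice, which puts its
  direction \<open>u\<close> into that subspace.
\<close>

lemma subspace_cover:
  fixes S :: "(complex^'m) set"
  assumes S: "vec.subspace S1" "vec.subspace S2" "vec.subspace S3" and "S1 \<union> S2 \<union> S3 = UNIV"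
  shows "S1 = UNIV \<or> S2 = UNIV \<or> S3 = (UNIV :: (complex^'m) set)"
proof (rule ccontr)
  assume "\<not> ?thesis"
  then obtain a b c where a: "a \<notin> S1" and b: "b \<notin> S2" and c: "c \<notin> S3"
    by blast
  obtain u where u: "u \<notin> S1" "u \<notin> S2"
  proof -
    have "a + b \<notin> S1" if "a \<in> S2" "b \<in> S1"
      using a that vec.subspace_diff[OF S(1), of "a + b" b] by auto
    moreover have "a + b \<notin> S2" if "a \<in> S2" "b \<in> S1"
      using b that vec.subspace_diff[OF S(2), of "a + b" a] by auto
    ultimately show thesis
      using a b that by blast
  qed
  then have "u \<in> S3"
    using assms(4) by blast
  have "c + t *s u \<notin> S3" for t
    using c vec.subspace_diff[OF S(3), of "c + t *s u" "t *s u"] vec.subspace_scale[OF S(3) \<open>u \<in> S3\<close>]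
    by auto
  then have cover: "c + t *s u \<in> S1 \<or> c + t *s u \<in> S2" for t
    using assms(4) by blast
  have *: "t = t'" if V: "vec.subspace V" "u \<notin> V" and "c + t *s u \<in> V" "c + t' *s u \<in> V" for t t' V
  proof (rule ccontr)
    assume "t \<noteq> t'"
    have "(t - t') *s u \<in> V"
      using vec.subspace_diff[OF V(1) that(3,4)] by (simp add: vec.scale_left_diff_distrib)
    then have "inverse (t - t') *s ((t - t') *s u) \<in> V"
      by (rule vec.subspace_scale[OF V(1)])
    then have "(inverse (t - t') * (t - t')) *s u \<in> V"
      by (simp only: vec.scale_scale)
    then show False
      using V(2) \<open>t \<noteq> t'\<close> by simp
  qed
  have "(0::complex) = 1 \<or> (0::complex) = 2 \<or> (1::complex) = 2"
    using cover[of 0] cover[of 1] cover[of 2] *[OF S(1) u(1)] *[OF S(2) u(2)] by metis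
  then show False
    by simp
qed

lemma row_injective_imp_column_injective:
  fixes D :: "'a::finite \<Rightarrow> 'a \<Rightarrow> complex"
  assumes "\<And>v. (\<And>x. (\<Sum>y\<in>UNIV. v y * D y x) = 0) \<Longrightarrow> v = (\<lambda>_. 0)"
    and "\<And>y. (\<Sum>x\<in>UNIV. D y x * c x) = 0"
  shows "c = (\<lambda>_. 0)"
proof -
  define M :: "complex^'a^'a" where "M = (\<chi> x y. D y x)"
  have "v = 0" if "M *v v = 0" for v
  proof -
    have "(\<lambda>y. v $ y) = (\<lambda>_. 0)"
    proof (rule assms(1))
      fix x
      have "(M *v v) $ x = (\<Sum>y\<in>UNIV. v $ y * D y x)"
        unfolding matrix_vector_mult_def M_def by (simp add: mult.commute)
      then show "(\<Sum>y\<in>UNIV. v $ y * D y x) = 0"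
        by (simp add: that)
    qed
    then show ?thesis
      by (metis vec_eq_iff zero_index)
  qed
  then obtain N where "N ** M = mat 1"
    using matrix_left_invertible_ker by metis
  then have "transpose N ** transpose M = mat 1"
    by (metis matrix_left_right_inverse matrix_transpose_mul transpose_mat)
  moreover have "transpose M *v (\<chi> x. c x) = 0"
    using assms(2) by (simp add: vec_eq_iff matrix_vector_mult_def M_def transpose_def)
  ultimately have "(\<chi> x. c x) = 0"
    using matrix_left_invertible_ker by metis
  then show ?thesis
    by (metis (mono_tags) ext vec_lambda_beta zero_index)
qed

lemma sum_UNIV_sum:
  "(\<Sum>x\<in>(UNIV :: ('a::finite + 'b::finite) set). f x) = (\<Sum>i\<in>UNIV. f (Inl i)) + (\<Sum>j\<in>UNIV. f (Inr j))"
  unfolding UNIV_sum by (subst sum.union_disjoint) (auto simp: sum.reindex)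

lemma two_elements:
  assumes "2 \<le> CARD('a::finite)"
  obtains a b :: "'a::finite" where "a \<noteq> b"
proof -
  have "\<not> CARD('a) \<le> Suc 0"
    using assms by simp
  then show thesis
    using that by (auto simp: card_le_Suc0_iff_eq)
qed

text \<open>
  The last four hypotheses are the conclusions of \<open>isomorphism_linear_part\<close>.  They force \<open>p = 0\<close>.
  By the degree two equations for words in a single colour, every combination of the corresponding
  rows of \<open>D\<close> solves the equations of the Gelfand space of \<open>\<theta>1\<close>.  The three parts of a minimal Gelfand space
  span linear subspaces, so that the whole row space of a colour lies in one of them; comparison of
  dimensions leaves only the block diagonal case.
\<close>

lemma linear_part_product:
  fixes \<theta>1 \<theta>2 :: "'n::finite \<times> 'm::finite \<Rightarrow> 'n \<times> 'm"
    and p :: "'n + 'm \<Rightarrow> complex" and D :: "'n + 'm \<Rightarrow> 'n + 'm \<Rightarrow> complex"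
  assumes card: "2 \<le> CARD('n)" "CARD('n) < CARD('m)"
    and bij: "bij \<theta>1" "bij \<theta>2" and min: "minimal_type \<theta>1"
    and rel0: "\<And>i j i' j'. \<theta>1 (i, j) = (i', j') \<Longrightarrow> p (Inl i) * p (Inr j) = p (Inl i') * p (Inr j')"
    and rel1: "\<And>i j i' j' y. \<theta>1 (i, j) = (i', j') \<Longrightarrow>
      D y (Inl i) * p (Inr j) + p (Inl i) * D y (Inr j) =
      D y (Inl i') * p (Inr j') + p (Inl i') * D y (Inr j')"
    and inj: "\<And>v. (\<And>x. (\<Sum>y\<in>UNIV. v y * D y x) = 0) \<Longrightarrow> v = (\<lambda>_. 0)"
    and rel2: "\<And>i j i' j' a b. (\<And>x. p x = 0) \<Longrightarrow> \<theta>1 (i, j) = (i', j') \<Longrightarrow>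
      (\<Sum>w\<in>cls \<theta>2 [a, b]. D (w ! 0) (Inl i) * D (w ! 1) (Inr j)) =
      (\<Sum>w\<in>cls \<theta>2 [a, b]. D (w ! 0) (Inr j') * D (w ! 1) (Inl i'))"
  shows "D (Inl k) (Inr j) = 0" "D (Inr l) (Inl i) = 0"
    "\<theta>1 (i, j) = (i', j') \<Longrightarrow> \<theta>2 (k, l) = (k', l') \<Longrightarrow>
      D (Inl k) (Inl i) * D (Inr l) (Inr j) = D (Inl k') (Inl i') * D (Inr l') (Inr j')"
proof -
  note col = row_injective_imp_column_injective[of D, OF inj]
  have col_neq: "\<exists>y. D y a \<noteq> D y b" if "a \<noteq> b" for a b
  proof (rule ccontr)
    assume *: "\<nexists>y. D y a \<noteq> D y b"
    have "(\<lambda>x. (if x = a then 1 else 0) - (if x = b then 1 else 0)) = (\<lambda>_. 0 :: complex)"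
    proof (rule col)
      fix y
      have "(\<Sum>x\<in>UNIV. D y x * ((if x = a then 1 else 0) - (if x = b then 1 else 0))) = D y a - D y b"
        by (simp add: right_diff_distrib sum_subtractf if_distrib[of "\<lambda>t. D y _ * t"] cong: if_cong)
      then show "(\<Sum>x\<in>UNIV. D y x * ((if x = a then 1 else 0) - (if x = b then 1 else 0))) = 0"
        using * by simp
    qed
    then show False
      using that by (auto dest!: fun_cong[of _ _ a])
  qed
  obtain i0 i1 :: 'n where i01: "i0 \<noteq> i1"
    using two_elements[OF card(1)] .
  obtain j0 j1 :: 'm where j01: "j0 \<noteq> j1"
    using two_elements[where 'a = 'm] card by fastforce

  have p0: "p x = 0" for x
  proof (rule ccontr)
    assume "p x \<noteq> 0"
    then have "\<exists>i. p (Inl i) \<noteq> 0 \<or> (\<exists>j. p (Inr j) \<noteq> 0)"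
      by (cases x) auto
    then consider "\<forall>i. p (Inl i) = 0" "\<exists>j. p (Inr j) \<noteq> 0" | "\<forall>j. p (Inr j) = 0" "\<exists>i. p (Inl i) \<noteq> 0"
      | "\<exists>i. p (Inl i) \<noteq> 0" "\<exists>j. p (Inr j) \<noteq> 0"
      by metis
    then show False
    proof cases
      case 1
      have "D y (Inl i0) = D y (Inl i1)" for y
      proof -
        have "D y (Inl i) * p (Inr j) = D y (Inl i') * p (Inr j')" if "\<theta>1 (i, j) = (i', j')" for i j i' j'
          using rel1[OF that, of y] 1 by simp
        from minimal_type_products[OF min, of "\<lambda>i. D y (Inl i)" "\<lambda>j. p (Inr j)", OF this] show ?thesis
          using 1(2) by metis
      qed
      then show False
        using col_neq[of "Inl i0" "Inl i1"] i01 by blast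
    next
      case 2
      have "D y (Inr j0) = D y (Inr j1)" for y
      proof -
        have "p (Inl i) * D y (Inr j) = p (Inl i') * D y (Inr j')" if "\<theta>1 (i, j) = (i', j')" for i j i' j'
          using rel1[OF that, of y] 2 by simp
        from minimal_type_products[OF min, of "\<lambda>i. p (Inl i)" "\<lambda>j. D y (Inr j)", OF this] show ?thesis
          using 2(2) by metis
      qed
      then show False
        using col_neq[of "Inr j0" "Inr j1"] j01 by blast
    next
      case 3
      obtain a b where a: "\<And>i. p (Inl i) = a" and b: "\<And>j. p (Inr j) = b" and ab: "a \<noteq> 0" "b \<noteq> 0"
        using minimal_type_products[OF min, of "\<lambda>i. p (Inl i)" "\<lambda>j. p (Inr j)"] rel0 3 by metis
      \<comment> \<open>Every product vector is fixed by the identity, which contradicts minimality.\<close>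
      have "\<exists>i j i' j'. \<theta>1 (i, j) = (i', j') \<and> (i, j) \<noteq> (i', j')"
      proof (rule ccontr)
        assume id: "\<not> ?thesis"
        define z :: "'n \<Rightarrow> complex" where "z i = (if i = i0 then 1 else 0)" for i
        have "(\<forall>i. z i = 0) \<or> (\<forall>j :: 'm. (1 :: complex) = 0) \<or>
            ((\<forall>i i'. z i = z i') \<and> (\<forall>(j :: 'm) (j' :: 'm). (1 :: complex) = 1))"
          by (rule minimal_type_products[OF min]) (use id in auto)
        then show False
          using i01 unfolding z_def by (metis zero_neq_one)
      qed
      then obtain i j i' j' where \<theta>: "\<theta>1 (i, j) = (i', j')" and neq: "(i, j) \<noteq> (i', j')"
        by blast
      define c :: "'n + 'm \<Rightarrow> complex" where "c x = (if x = Inl i then b else 0) + (if x = Inr j then a else 0)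
        - (if x = Inl i' then b else 0) - (if x = Inr j' then a else 0)" for x
      have "c = (\<lambda>_. 0)"
      proof (rule col)
        fix y
        have "(\<Sum>x\<in>UNIV. D y x * c x) = D y (Inl i) * b + D y (Inr j) * a - D y (Inl i') * b - D y (Inr j') * a"
          unfolding c_def
          by (simp add: right_diff_distrib distrib_left sum.distrib sum_subtractf
              if_distrib[of "\<lambda>t. D y _ * t"] cong: if_cong)
        then show "(\<Sum>x\<in>UNIV. D y x * c x) = 0"
          using rel1[OF \<theta>, of y] by (simp add: a b algebra_simps)
      qed
      then have "c (Inl i) = 0" "c (Inr j) = 0"
        by simp_all
      then show False
        using neq ab by (auto simp: c_def split: if_splits)
    qed
  qed

  note rel2 = rel2[OF p0]
  \<comment> \<open>Here \<open>g\<close> is \<open>Inl\<close> or \<open>Inr\<close>: words of length two in one colour are congruent only to themselves.\<close>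
  have quad: "(\<Sum>k\<in>UNIV. v k * D (g k) (Inl i)) * (\<Sum>k\<in>UNIV. v k * D (g k) (Inr j)) =
      (\<Sum>k\<in>UNIV. v k * D (g k) (Inl i')) * (\<Sum>k\<in>UNIV. v k * D (g k) (Inr j'))"
    if g: "\<And>k l. cls \<theta>2 [g k, g l] = {[g k, g l]}" and \<theta>: "\<theta>1 (i, j) = (i', j')"
    for g :: "'c::finite \<Rightarrow> 'n + 'm" and v i j i' j'
  proof -
    have *: "D (g k) (Inl i) * D (g l) (Inr j) = D (g l) (Inl i') * D (g k) (Inr j')" for k l
      using rel2[OF \<theta>, of "g k" "g l"] by (simp add: g mult.commute)
    have "(\<Sum>k\<in>UNIV. v k * D (g k) (Inl i)) * (\<Sum>k\<in>UNIV. v k * D (g k) (Inr j)) =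
        (\<Sum>k\<in>UNIV. \<Sum>l\<in>UNIV. v k * v l * (D (g k) (Inl i) * D (g l) (Inr j)))"
      by (simp add: sum_product mult.assoc mult.left_commute)
    also have "\<dots> = (\<Sum>k\<in>UNIV. \<Sum>l\<in>UNIV. v l * v k * (D (g l) (Inl i') * D (g k) (Inr j')))"
      by (simp only: * mult.commute[of "v _" "v _"])
    also have "\<dots> = (\<Sum>l\<in>UNIV. \<Sum>k\<in>UNIV. v l * v k * (D (g l) (Inl i') * D (g k) (Inr j')))"
      by (rule sum.swap)
    also have "\<dots> = (\<Sum>k\<in>UNIV. v k * D (g k) (Inl i')) * (\<Sum>k\<in>UNIV. v k * D (g k) (Inr j'))"
      by (simp add: sum_product mult.assoc mult.left_commute)
    finally show ?thesis .
  qed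
  have cases: "(\<forall>k i. D (g k) (Inl i) = 0) \<or> (\<forall>k j. D (g k) (Inr j) = 0) \<or>
      (\<forall>k. (\<forall>i i'. D (g k) (Inl i) = D (g k) (Inl i')) \<and> (\<forall>j j'. D (g k) (Inr j) = D (g k) (Inr j')))"
    if g: "\<And>k l. cls \<theta>2 [g k, g l] = {[g k, g l]}" for g :: "'c::finite \<Rightarrow> 'n + 'm"
  proof -
    define X where "X v i = (\<Sum>k\<in>UNIV. v $ k * D (g k) (Inl i))" for v :: "complex^'c" and i
    define Y where "Y v j = (\<Sum>k\<in>UNIV. v $ k * D (g k) (Inr j))" for v :: "complex^'c" and j
    have lin: "X 0 i = 0" "X (v + w) i = X v i + X w i" "X (c *s v) i = c * X v i"
      "Y 0 j = 0" "Y (v + w) j = Y v j + Y w j" "Y (c *s v) j = c * Y v j" for v w c i j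
      by (simp_all add: X_def Y_def distrib_right sum.distrib sum_distrib_left mult.assoc)
    have unit: "X (axis k 1) i = D (g k) (Inl i)" "Y (axis k 1) j = D (g k) (Inr j)" for k i j
      by (simp_all add: X_def Y_def axis_def if_distrib[of "\<lambda>t. t * _"] cong: if_cong)
    define S1 where "S1 = {v. \<forall>i. X v i = 0}"
    define S2 where "S2 = {v. \<forall>j. Y v j = 0}"
    define S3 where "S3 = {v. (\<forall>i i'. X v i = X v i') \<and> (\<forall>j j'. Y v j = Y v j')}"
    have "vec.subspace S1" "vec.subspace S2"
      by (auto simp: S1_def S2_def vec.subspace_def lin)
    moreover have "vec.subspace S3"
      unfolding S3_def vec.subspace_def by (simp add: lin) metis
    moreover have "S1 \<union> S2 \<union> S3 = UNIV"
    proof -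
      have "v \<in> S1 \<or> v \<in> S2 \<or> v \<in> S3" for v
        using minimal_type_products[OF min, of "X v" "Y v"] quad[OF g, of _ _ _ _ "\<lambda>k. v $ k"]
        by (auto simp: S1_def S2_def S3_def X_def Y_def)
      then show ?thesis by blast
    qed
    ultimately have "S1 = UNIV \<or> S2 = UNIV \<or> S3 = UNIV"
      by (rule subspace_cover)
    then have "(\<forall>k. axis k 1 \<in> S1) \<or> (\<forall>k. axis k 1 \<in> S2) \<or> (\<forall>k. axis k 1 \<in> S3)"
      by blast
    then show ?thesis
      by (simp add: S1_def S2_def S3_def unit)
  qed
  \<comment> \<open>The rows \<open>Inr l\<close> are independent, and they are too many to fit in either alternative to \<open>fe\<close>.\<close>
  have no_kernel: False if "w \<noteq> 0" "\<And>x. (\<Sum>l\<in>UNIV. w $ l * D (Inr l) x) = 0" for w :: "complex^'m"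
  proof -
    have "case_sum (\<lambda>_ :: 'n. 0) (\<lambda>l. w $ l) = (\<lambda>_. 0)"
      by (rule inj) (simp add: sum_UNIV_sum that(2))
    then have "w $ l = 0" for l
      by (metis sum.case(2))
    then show False
      using that(1) by (simp add: vec_eq_iff)
  qed
  have fe: "D (Inr l) (Inl i) = 0" for l i
  proof (rule ccontr)
    assume "D (Inr l) (Inl i) \<noteq> 0"
    then consider "\<And>l j. D (Inr l) (Inr j) = 0"
      | "\<And>l i i'. D (Inr l) (Inl i) = D (Inr l) (Inl i')" "\<And>l j j'. D (Inr l) (Inr j) = D (Inr l) (Inr j')"
      using cases[of Inr] word_cong_two(2)[OF bij(2)] by metis
    then show False
    proof cases
      case 1
      obtain w :: "complex^'m" where w: "w \<noteq> 0" "(\<chi> i l. D (Inr l) (Inl i)) *v w = (0 :: complex^'n)"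
        using kernel_nontrivial[OF card(2)] by metis
      then have "(\<Sum>l\<in>UNIV. w $ l * D (Inr l) x) = 0" for x
        using 1 by (cases x) (auto simp: vec_eq_iff matrix_vector_mult_def mult.commute)
      then show False
        using no_kernel w(1) by blast
    next
      case 2
      have "CARD(2) < CARD('m)"
        using card by simp
      then obtain w :: "complex^'m" where w: "w \<noteq> 0"
        "(\<chi> t l. D (Inr l) (if t = 1 then Inl i0 else Inr j0)) *v w = (0 :: complex^2)"
        by (rule kernel_nontrivial)
      have "(\<Sum>l\<in>UNIV. w $ l * D (Inr l) (if t = (1 :: 2) then Inl i0 else Inr j0)) = 0" for t
        using w(2) by (simp add: vec_eq_iff matrix_vector_mult_def mult.commute)
      from this[of 1] this[of 2]
      have *: "(\<Sum>l\<in>UNIV. w $ l * D (Inr l) (Inl i0)) = 0" "(\<Sum>l\<in>UNIV. w $ l * D (Inr l) (Inr j0)) = 0"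
        by simp_all
      have "(\<Sum>l\<in>UNIV. w $ l * D (Inr l) x) = 0" for x
      proof (cases x)
        case (Inl i)
        show ?thesis
          unfolding Inl 2(1)[of _ i i0] by (rule *(1))
      next
        case (Inr j)
        show ?thesis
          unfolding Inr 2(2)[of _ j j0] by (rule *(2))
      qed
      then show False
        using no_kernel w(1) by blast
    qed
  qed
  have ef: "D (Inl k) (Inr j) = 0" for k j
  proof (rule ccontr)
    assume "D (Inl k) (Inr j) \<noteq> 0"
    then have "D (Inl k) (Inl i0) = D (Inl k) (Inl i1)" for k
      using cases[of Inl] word_cong_two(1)[OF bij(2)] by metis
    then have "D y (Inl i0) = D y (Inl i1)" for y
      by (cases y) (simp_all add: fe)
    then show False
      using col_neq[of "Inl i0" "Inl i1"] i01 by blast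
  qed
  show "D (Inl k) (Inr j) = 0" "D (Inr l) (Inl i) = 0"
    by (rule ef fe)+
  show "D (Inl k) (Inl i) * D (Inr l) (Inr j) = D (Inl k') (Inl i') * D (Inr l') (Inr j')"
    if "\<theta>1 (i, j) = (i', j')" "\<theta>2 (k, l) = (k', l')"
    using rel2[OF that(1), of "Inl k" "Inr l"]
    by (simp add: word_cong_two(3)[OF bij(2) that(2)] ef fe mult.commute)
qed

section \<open>Trace invariants of a permutation of a rectangle\<close>

definition same_row :: "'n \<times> 'm \<Rightarrow> 'n \<times> 'm \<Rightarrow> bool" where
  "same_row x y \<longleftrightarrow> fst x = fst y"

definition same_column :: "'n \<times> 'm \<Rightarrow> 'n \<times> 'm \<Rightarrow> bool" where
  "same_column x y \<longleftrightarrow> snd x = snd y"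

text \<open>
  This is the trace of the product of the relation matrices of \<open>R\<close> and \<open>S\<close> with powers of the
  permutation matrix of \<open>\<theta>\<close>, in alternation; see \<open>trace_link_count\<close>.
\<close>

definition link_count :: "('c \<Rightarrow> 'c \<Rightarrow> bool) \<Rightarrow> nat \<Rightarrow> ('c \<Rightarrow> 'c \<Rightarrow> bool) \<Rightarrow> nat \<Rightarrow> ('c \<Rightarrow> 'c) \<Rightarrow> nat" where
  "link_count R a S b \<theta> = card {(x, y). R x ((\<theta> ^^ a) y) \<and> S y ((\<theta> ^^ b) x)}"

definition relation_matrix :: "('c \<Rightarrow> 'c \<Rightarrow> bool) \<Rightarrow> complex^'c^'c" where
  "relation_matrix R = (\<chi> x y. if R x y then 1 else 0)"

abbreviation map_matrix :: "('c \<Rightarrow> 'c) \<Rightarrow> complex^'c^'c" where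
  "map_matrix f \<equiv> relation_matrix (\<lambda>x y. x = f y)"

lemma matrix_mult_map_matrix: "(M ** map_matrix f) $ x $ y = M $ x $ f y"
  by (simp add: matrix_matrix_mult_def relation_matrix_def if_distrib[of "\<lambda>t. _ * t"] cong: if_cong)

lemma trace_link_count:
  fixes \<theta> :: "'c::finite \<Rightarrow> 'c"
  shows "trace ((relation_matrix R ** map_matrix (\<theta> ^^ a)) ** (relation_matrix S ** map_matrix (\<theta> ^^ b))) =
    of_nat (link_count R a S b \<theta>)"
proof -
  have "trace ((relation_matrix R ** map_matrix (\<theta> ^^ a)) ** (relation_matrix S ** map_matrix (\<theta> ^^ b))) =
      (\<Sum>x\<in>UNIV. \<Sum>y\<in>UNIV. if R x ((\<theta> ^^ a) y) \<and> S y ((\<theta> ^^ b) x) then 1 else 0)"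
    unfolding trace_def matrix_matrix_mult_def[of "_ ** _"] vec_lambda_beta matrix_mult_map_matrix
    by (simp add: relation_matrix_def) (intro sum.cong refl, auto)
  also have "\<dots> = (\<Sum>p\<in>UNIV. if p \<in> {(x, y). R x ((\<theta> ^^ a) y) \<and> S y ((\<theta> ^^ b) x)} then 1 else 0)"
    by (simp add: sum.cartesian_product case_prod_unfold)
  also have "\<dots> = of_nat (link_count R a S b \<theta>)"
    by (simp add: link_count_def sum.If_cases)
  finally show ?thesis .
qed

text \<open>
  The invariance of the entries of \<open>C\<close> says that \<open>C\<close> intertwines the permutation matrices; the
  traces in question therefore belong to similar matrices.
\<close>

lemma link_count_intertwined:
  fixes C C' :: "complex^'c::finite^'c"
  assumes inv: "C' ** C = mat 1"
    and \<theta>: "\<And>x y. C $ \<theta>2 x $ \<theta>1 y = C $ x $ y" and bij: "bij \<theta>2"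
    and R: "C ** relation_matrix R = relation_matrix R ** C"
    and S: "C ** relation_matrix S = relation_matrix S ** C"
  shows "link_count R a S b \<theta>1 = link_count R a S b \<theta>2"
proof -
  have map: "C ** map_matrix (\<theta>1 ^^ k) = map_matrix (\<theta>2 ^^ k) ** C" for k
  proof -
    have pow: "C $ (\<theta>2 ^^ k) x $ (\<theta>1 ^^ k) y = C $ x $ y" for x y
      by (induction k) (simp_all add: \<theta>)
    have bijk: "bij (\<theta>2 ^^ k)"
      using bij by (rule bij_betw_funpow)
    have "C $ x $ (\<theta>1 ^^ k) y = (map_matrix (\<theta>2 ^^ k) ** C) $ x $ y" for x y
    proof -
      obtain z where z: "x = (\<theta>2 ^^ k) z"
        using bijk by (metis bij_pointE)
      have "(map_matrix (\<theta>2 ^^ k) ** C) $ x $ y = (\<Sum>w\<in>UNIV. if w = z then C $ w $ y else 0)"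
        unfolding matrix_matrix_mult_def relation_matrix_def z
        by (auto simp: inj_eq[OF bij_is_inj[OF bijk]] if_distrib[of "\<lambda>t. t * _"] cong: if_cong)
      then show ?thesis
        by (simp add: z pow)
    qed
    then show ?thesis
      by (simp add: vec_eq_iff matrix_mult_map_matrix)
  qed
  define M where "M \<theta> = (relation_matrix R ** map_matrix (\<theta> ^^ a)) ** (relation_matrix S ** map_matrix (\<theta> ^^ b))" for \<theta>
  have comp: "C ** (X ** Y) = (X' ** Y') ** C" if "C ** X = X' ** C" "C ** Y = Y' ** C" for X Y X' Y'
    by (metis matrix_mul_assoc that)
  have "C ** M \<theta>1 = M \<theta>2 ** C"
    unfolding M_def by (intro comp R S map)
  then have "trace (M \<theta>1) = trace (C' ** (M \<theta>2 ** C))"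
    by (metis inv matrix_mul_assoc matrix_mul_lid)
  also have "\<dots> = trace (M \<theta>2)"
    using inv by (metis matrix_left_right_inverse matrix_mul_assoc matrix_mul_rid trace_mul_sym)
  finally show ?thesis
    by (simp add: M_def trace_link_count)
qed

text \<open>
  Summing the intertwining relation over all cells shows that the row sums of \<open>A\<close> and \<open>B\<close> solve
  the equations of the Gelfand space of \<open>\<theta>2\<close>, and the column sums those of \<open>\<theta>1\<close>.  They do not vanish,
  as \<open>A\<close> and \<open>B\<close> are invertible, so that they are constant.  This is what makes \<open>A \<otimes> B\<close> commute with
  the matrices of the relations \<open>same_row\<close> and \<open>same_column\<close>.
\<close>

lemma link_count_product_intertwined:
  fixes A :: "'n::finite \<Rightarrow> 'n \<Rightarrow> complex" and B :: "'m::finite \<Rightarrow> 'm \<Rightarrow> complex"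
  assumes A: "\<And>v. (\<And>i. (\<Sum>k\<in>UNIV. v k * A k i) = 0) \<Longrightarrow> v = (\<lambda>_. 0)"
    and B: "\<And>v. (\<And>j. (\<Sum>l\<in>UNIV. v l * B l j) = 0) \<Longrightarrow> v = (\<lambda>_. 0)"
    and \<theta>: "\<And>i j k l i' j' k' l'. \<theta>1 (i, j) = (i', j') \<Longrightarrow> \<theta>2 (k, l) = (k', l') \<Longrightarrow>
      A k i * B l j = A k' i' * B l' j'"
    and bij: "bij \<theta>1" "bij \<theta>2" and min: "minimal_type \<theta>1" "minimal_type \<theta>2"
    and RS: "R \<in> {same_row, same_column}" "S \<in> {same_row, same_column}"
  shows "link_count R a S b \<theta>1 = link_count R a S b \<theta>2"
proof -
  have colA: "c = (\<lambda>_. 0)" if "\<And>k. (\<Sum>i\<in>UNIV. A k i * c i) = 0" for c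
    using A that by (rule row_injective_imp_column_injective)
  have colB: "c = (\<lambda>_. 0)" if "\<And>l. (\<Sum>j\<in>UNIV. B l j * c j) = 0" for c
    using B that by (rule row_injective_imp_column_injective)
  have total: "(\<Sum>i\<in>UNIV. f i) * (\<Sum>j\<in>UNIV. g j) = (\<Sum>p\<in>UNIV. f (fst p) * g (snd p))"
    for f :: "'n \<Rightarrow> complex" and g :: "'m \<Rightarrow> complex"
    by (simp add: sum_product sum.cartesian_product case_prod_unfold)
  have rows: "(\<forall>k k'. (\<Sum>i\<in>UNIV. A k i) = (\<Sum>i\<in>UNIV. A k' i)) \<and> (\<forall>l l'. (\<Sum>j\<in>UNIV. B l j) = (\<Sum>j\<in>UNIV. B l' j))"
  proof -
    have "(\<Sum>i\<in>UNIV. A k i) * (\<Sum>j\<in>UNIV. B l j) = (\<Sum>i\<in>UNIV. A k' i) * (\<Sum>j\<in>UNIV. B l' j)"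
      if "\<theta>2 (k, l) = (k', l')" for k l k' l'
    proof -
      have "(\<Sum>p\<in>UNIV. A k' (fst p) * B l' (snd p)) =
          (\<Sum>p\<in>UNIV. A k' (fst (\<theta>1 p)) * B l' (snd (\<theta>1 p)))"
        by (rule sum.reindex_bij_betw[symmetric]) (rule bij(1))
      also have "\<dots> = (\<Sum>p\<in>UNIV. A k (fst p) * B l (snd p))"
        by (rule sum.cong) (auto intro: \<theta>[OF _ that, symmetric])
      finally show ?thesis
        by (simp add: total)
    qed
    from minimal_type_products[OF min(2), of "\<lambda>k. \<Sum>i\<in>UNIV. A k i" "\<lambda>l. \<Sum>j\<in>UNIV. B l j", OF this]
    show ?thesis
      using colA[of "\<lambda>_. 1"] colB[of "\<lambda>_. 1"] by (auto simp: fun_eq_iff)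
  qed
  have columns: "(\<forall>i i'. (\<Sum>k\<in>UNIV. A k i) = (\<Sum>k\<in>UNIV. A k i')) \<and> (\<forall>j j'. (\<Sum>l\<in>UNIV. B l j) = (\<Sum>l\<in>UNIV. B l j'))"
  proof -
    have "(\<Sum>k\<in>UNIV. A k i) * (\<Sum>l\<in>UNIV. B l j) = (\<Sum>k\<in>UNIV. A k i') * (\<Sum>l\<in>UNIV. B l j')"
      if "\<theta>1 (i, j) = (i', j')" for i j i' j'
    proof -
      have "(\<Sum>p\<in>UNIV. A (fst p) i' * B (snd p) j') =
          (\<Sum>p\<in>UNIV. A (fst (\<theta>2 p)) i' * B (snd (\<theta>2 p)) j')"
        by (rule sum.reindex_bij_betw[symmetric]) (rule bij(2))
      also have "\<dots> = (\<Sum>p\<in>UNIV. A (fst p) i * B (snd p) j)"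
        by (rule sum.cong) (auto intro: \<theta>[OF that, symmetric])
      finally show ?thesis
        by (simp add: total)
    qed
    from minimal_type_products[OF min(1), of "\<lambda>i. \<Sum>k\<in>UNIV. A k i" "\<lambda>j. \<Sum>l\<in>UNIV. B l j", OF this]
    show ?thesis
      using A[of "\<lambda>_. 1"] B[of "\<lambda>_. 1"] by (auto simp: fun_eq_iff)
  qed
  have row_column: "(\<Sum>i\<in>UNIV. F k i) = (\<Sum>k\<in>UNIV. F k i)"
    if "\<forall>k k'. (\<Sum>i\<in>UNIV. F k i) = (\<Sum>i\<in>UNIV. F k' i)" "\<forall>i i'. (\<Sum>k\<in>UNIV. F k i) = (\<Sum>k\<in>UNIV. F k i')"
    for F :: "'c::finite \<Rightarrow> 'c \<Rightarrow> complex" and k i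
  proof -
    have "of_nat CARD('c) * (\<Sum>i\<in>UNIV. F k i) = (\<Sum>k\<in>UNIV. \<Sum>i\<in>UNIV. F k i)"
      using that(1) by (subst sum.cong[OF HOL.refl, of _ _ "\<lambda>_. \<Sum>i\<in>UNIV. F k i"]) auto
    also have "\<dots> = (\<Sum>i\<in>UNIV. \<Sum>k\<in>UNIV. F k i)"
      by (rule sum.swap)
    also have "\<dots> = of_nat CARD('c) * (\<Sum>k\<in>UNIV. F k i)"
      using that(2) by (subst sum.cong[OF HOL.refl, of _ _ "\<lambda>_. \<Sum>k\<in>UNIV. F k i"]) auto
    finally show ?thesis
      by simp
  qed
  define C :: "complex^('n \<times> 'm)^('n \<times> 'm)" where "C = (\<chi> x y. A (fst x) (fst y) * B (snd x) (snd y))"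
  have split: "(\<Sum>p\<in>UNIV. f p) = (\<Sum>i\<in>UNIV. \<Sum>j\<in>UNIV. f (i, j))" for f :: "'n \<times> 'm \<Rightarrow> complex"
    by (simp add: sum.cartesian_product)
  have "C *v v = 0 \<longrightarrow> v = 0" for v
  proof
    assume v: "C *v v = 0"
    have 1: "(\<Sum>i\<in>UNIV. A k i * (\<Sum>j\<in>UNIV. B l j * v $ (i, j))) = 0" for k l
      using v[THEN arg_cong, of "\<lambda>u. u $ (k, l)"]
      by (simp add: matrix_vector_mult_def C_def split sum_distrib_left mult.assoc)
    have 2: "(\<Sum>j\<in>UNIV. B l j * v $ (i, j)) = 0" for i l
      using colA[of "\<lambda>i. \<Sum>j\<in>UNIV. B l j * v $ (i, j)", OF 1] by (rule fun_cong)
    have "v $ (i, j) = 0" for i j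
      using colB[of "\<lambda>j. v $ (i, j)", OF 2] by (rule fun_cong)
    then show "v = 0"
      by (simp add: vec_eq_iff)
  qed
  then obtain C' where inv: "C' ** C = mat 1"
    using matrix_left_invertible_ker by blast
  have commute: "C ** relation_matrix T = relation_matrix T ** C" if T: "T \<in> {same_row, same_column}" for T
  proof -
    have "(C ** relation_matrix T) $ x $ y = (relation_matrix T ** C) $ x $ y" for x y
    proof -
      obtain k l i j where xy: "x = (k, l)" "y = (i, j)"
        by fastforce
      have A': "(\<Sum>j\<in>UNIV. B l j) = (\<Sum>l\<in>UNIV. B l j)" and B': "(\<Sum>i\<in>UNIV. A k i) = (\<Sum>k\<in>UNIV. A k i)"
        using rows columns by (blast intro: row_column)+
      note delta = if_distrib[of "\<lambda>t. _ * t"] if_distrib[of "\<lambda>t. t * _"]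
      consider "T = same_row" | "T = same_column"
        using T by auto
      then show ?thesis
      proof cases
        case 1
        have "(C ** relation_matrix T) $ x $ y =
            (\<Sum>p\<in>UNIV. (A k (fst p) * (if fst p = i then 1 else 0)) * B l (snd p))"
          unfolding matrix_matrix_mult_def relation_matrix_def C_def
          by (auto simp: same_row_def xy 1 intro!: sum.cong)
        also have "\<dots> = (\<Sum>i'\<in>UNIV. A k i' * (if i' = i then 1 else 0)) * (\<Sum>j\<in>UNIV. B l j)"
          by (simp only: total)
        also have "\<dots> = (\<Sum>k'\<in>UNIV. (if k' = k then 1 else 0) * A k' i) * (\<Sum>l\<in>UNIV. B l j)"
          using A' by (simp add: delta cong: if_cong)
        also have "\<dots> = (\<Sum>p\<in>UNIV. ((if fst p = k then 1 else 0) * A (fst p) i) * B (snd p) j)"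
          by (simp only: total)
        also have "\<dots> = (relation_matrix T ** C) $ x $ y"
          unfolding matrix_matrix_mult_def relation_matrix_def C_def
          by (auto simp: same_row_def xy 1 intro!: sum.cong)
        finally show ?thesis .
      next
        case 2
        have "(C ** relation_matrix T) $ x $ y =
            (\<Sum>p\<in>UNIV. A k (fst p) * (B l (snd p) * (if snd p = j then 1 else 0)))"
          unfolding matrix_matrix_mult_def relation_matrix_def C_def
          by (auto simp: same_column_def xy 2 intro!: sum.cong)
        also have "\<dots> = (\<Sum>i\<in>UNIV. A k i) * (\<Sum>j'\<in>UNIV. B l j' * (if j' = j then 1 else 0))"
          by (simp only: total)
        also have "\<dots> = (\<Sum>k\<in>UNIV. A k i) * (\<Sum>l'\<in>UNIV. (if l' = l then 1 else 0) * B l' j)"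
          using B' by (simp add: delta cong: if_cong)
        also have "\<dots> = (\<Sum>p\<in>UNIV. A (fst p) i * ((if snd p = l then 1 else 0) * B (snd p) j))"
          by (simp only: total)
        also have "\<dots> = (relation_matrix T ** C) $ x $ y"
          unfolding matrix_matrix_mult_def relation_matrix_def C_def
          by (auto simp: same_column_def xy 2 intro!: sum.cong)
        finally show ?thesis .
      qed
    qed
    then show ?thesis
      by (simp add: vec_eq_iff)
  qed
  show ?thesis
    using inv _ bij(2) commute[OF RS(1)] commute[OF RS(2)]
  proof (rule link_count_intertwined)
    show "C $ \<theta>2 x $ \<theta>1 y = C $ x $ y" for x y
      using \<theta>[of "fst y" "snd y" "fst (\<theta>1 y)" "snd (\<theta>1 y)" "fst x" "snd x" "fst (\<theta>2 x)" "snd (\<theta>2 x)"]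
      by (simp add: C_def)
  qed
qed

theorem isomorphic_imp_link_count_eq:
  fixes \<theta>1 \<theta>2 :: "'n::finite \<times> 'm::finite \<Rightarrow> 'n \<times> 'm"
  assumes card: "2 \<le> CARD('n)" "CARD('n) < CARD('m)"
    and bij: "bij \<theta>1" "bij \<theta>2" and min: "minimal_type \<theta>1" "minimal_type \<theta>2"
    and iso: "isometrically_isomorphic (toeplitz_algebra (two_graph \<theta>1)) (toeplitz_algebra (two_graph \<theta>2))"
    and RS: "R \<in> {same_row, same_column}" "S \<in> {same_row, same_column}"
  shows "link_count R a S b \<theta>1 = link_count R a S b \<theta>2"
proof -
  obtain p :: "'n + 'm \<Rightarrow> complex" and D :: "'n + 'm \<Rightarrow> 'n + 'm \<Rightarrow> complex" where
    D0: "\<And>i j i' j'. \<theta>1 (i, j) = (i', j') \<Longrightarrow> p (Inl i) * p (Inr j) = p (Inl i') * p (Inr j')" and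
    D1: "\<And>i j i' j' y. \<theta>1 (i, j) = (i', j') \<Longrightarrow>
      D y (Inl i) * p (Inr j) + p (Inl i) * D y (Inr j) =
      D y (Inl i') * p (Inr j') + p (Inl i') * D y (Inr j')" and
    inj: "\<And>v. (\<And>x. (\<Sum>y\<in>UNIV. v y * D y x) = 0) \<Longrightarrow> v = (\<lambda>_. 0)" and
    D2: "\<And>i j i' j' a b. (\<And>x. p x = 0) \<Longrightarrow> \<theta>1 (i, j) = (i', j') \<Longrightarrow>
      (\<Sum>w\<in>cls \<theta>2 [a, b]. D (w ! 0) (Inl i) * D (w ! 1) (Inr j)) =
      (\<Sum>w\<in>cls \<theta>2 [a, b]. D (w ! 0) (Inr j') * D (w ! 1) (Inl i'))"
    using isomorphism_linear_part[OF bij iso] by blast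
  note prod = linear_part_product[OF card bij min(1), of p D, OF D0 D1 inj D2]
  have off: "D (Inl k) (Inr j) = 0" "D (Inr l) (Inl i) = 0" for i j k l
    by (rule prod; assumption)+
  show ?thesis
  proof (rule link_count_product_intertwined[where A = "\<lambda>k i. D (Inl k) (Inl i)" and B = "\<lambda>l j. D (Inr l) (Inr j)"])
    show "v = (\<lambda>_. 0)" if "\<And>i. (\<Sum>k\<in>UNIV. v k * D (Inl k) (Inl i)) = 0" for v
    proof -
      have "(\<Sum>y\<in>UNIV. case_sum v (\<lambda>_ :: 'm. 0) y * D y x) = 0" for x
        using that by (cases x) (simp_all add: sum_UNIV_sum off)
      then have "case_sum v (\<lambda>_ :: 'm. 0) = (\<lambda>_. 0)"
        by (rule inj)
      then show ?thesis
        by (metis sum.case(1) ext)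
    qed
    show "v = (\<lambda>_. 0)" if "\<And>j. (\<Sum>l\<in>UNIV. v l * D (Inr l) (Inr j)) = 0" for v
    proof -
      have "(\<Sum>y\<in>UNIV. case_sum (\<lambda>_ :: 'n. 0) v y * D y x) = 0" for x
        using that by (cases x) (simp_all add: sum_UNIV_sum off)
      then have "case_sum (\<lambda>_ :: 'n. 0) v = (\<lambda>_. 0)"
        by (rule inj)
      then show ?thesis
        by (metis sum.case(2) ext)
    qed
    show "D (Inl k) (Inl i) * D (Inr l) (Inr j) = D (Inl k') (Inl i') * D (Inr l') (Inr j')"
      if "\<theta>1 (i, j) = (i', j')" "\<theta>2 (k, l) = (k', l')" for i j k l i' j' k' l'
      by (rule prod(3)) (assumption | rule that)+
  qed (use bij min RS in auto)
qed

section \<open>Isomorphic semigroups have isometrically isomorphic Toeplitz algebras\<close>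

lemma word_cong_map:
  assumes "\<And>i j. \<theta>2 (\<sigma> i, \<tau> j) = map_prod \<sigma> \<tau> (\<theta>1 (i, j))"
  shows "word_cong \<theta>1 u v \<Longrightarrow>
    word_cong \<theta>2 (map (map_sum \<sigma> \<tau>) u) (map (map_sum \<sigma> \<tau>) v)"
proof (induction rule: word_cong.induct)
  case (commute i j i' j' u v)
  then have "\<theta>2 (\<sigma> i, \<tau> j) = (\<sigma> i', \<tau> j')"
    by (simp add: assms)
  then show ?case
    by (simp add: word_cong.commute[simplified])
qed (blast intro: word_cong.intros)+

lemma product_conjugate_imp_iso:
  assumes conj: "\<And>i j. \<theta>2 (\<sigma> i, \<tau> j) = map_prod \<sigma> \<tau> (\<theta>1 (i, j))" and bij: "bij \<sigma>" "bij \<tau>"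
  shows "two_graph \<theta>1 \<cong> two_graph \<theta>2"
proof -
  define \<sigma>' where "\<sigma>' = inv_into UNIV \<sigma>"
  define \<tau>' where "\<tau>' = inv_into UNIV \<tau>"
  let ?g = "map (map_sum \<sigma> \<tau>)" and ?k = "map (map_sum \<sigma>' \<tau>')"
  have inv: "\<sigma> (\<sigma>' i) = i" "\<tau> (\<tau>' j) = j" "\<sigma>' (\<sigma> i') = i'" "\<tau>' (\<tau> j') = j'" for i j i' j'
    using bij by (simp_all add: \<sigma>'_def \<tau>'_def bij_is_surj surj_f_inv_f bij_is_inj inv_f_f)
  have gk: "?g (?k w) = w" "?k (?g w') = w'" for w w'
    by (simp_all add: map_idI sum.map_comp comp_def inv sum.map_ident)
  have conj': "\<theta>1 (\<sigma>' i, \<tau>' j) = map_prod \<sigma>' \<tau>' (\<theta>2 (i, j))" for i j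
    using conj[of "\<sigma>' i" "\<tau>' j"] by (cases "\<theta>1 (\<sigma>' i, \<tau>' j)") (simp add: inv)
  have image: "?g ` cls \<theta>1 u = cls \<theta>2 (?g u)" for u
  proof
    show "?g ` cls \<theta>1 u \<subseteq> cls \<theta>2 (?g u)"
      by (auto intro: word_cong_map[of \<theta>2 \<sigma> \<tau> \<theta>1] conj)
    show "cls \<theta>2 (?g u) \<subseteq> ?g ` cls \<theta>1 u"
    proof
      fix w assume "w \<in> cls \<theta>2 (?g u)"
      then have "word_cong \<theta>2 (?g u) w"
        by simp
      then have "word_cong \<theta>1 (?k (?g u)) (?k w)"
        by (rule word_cong_map[of \<theta>1 \<sigma>' \<tau>' \<theta>2, OF conj'])
      then show "w \<in> ?g ` cls \<theta>1 u"
        by (intro image_eqI[of _ _ "?k w"]) (simp_all only: gk mem_Collect_eq)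
    qed
  qed
  have "inj ?g"
    by (rule inj_on_inverseI[of _ ?k]) (rule gk(2))
  then have "inj_on (image ?g) (carrier (two_graph \<theta>1))"
    by (simp add: inj_on_def inj_image_eq_iff)
  moreover have "image ?g ` carrier (two_graph \<theta>1) = carrier (two_graph \<theta>2)"
  proof -
    have "cls \<theta>2 w \<in> range (\<lambda>u. cls \<theta>2 (?g u))" for w
      by (rule range_eqI[of _ _ "?k w"]) (simp only: gk)
    then show ?thesis
      by (auto simp: two_graph_carrier image_image image)
  qed
  moreover have "image ?g \<in> hom (two_graph \<theta>1) (two_graph \<theta>2)"
  proof (rule homI)
    fix X Y assume "X \<in> carrier (two_graph \<theta>1)" "Y \<in> carrier (two_graph \<theta>1)"
    then obtain u v where "X = cls \<theta>1 u" "Y = cls \<theta>1 v"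
      by (auto simp: two_graph_carrier)
    then show "?g ` (X \<otimes>\<^bsub>two_graph \<theta>1\<^esub> Y) = ?g ` X \<otimes>\<^bsub>two_graph \<theta>2\<^esub> ?g ` Y"
      by (simp only: two_graph_mult image map_append)
  qed (use calculation in auto)
  ultimately show ?thesis
    by (auto simp: is_iso_def iso_def bij_betw_def)
qed

text \<open>
  For an injective \<open>f\<close> this is the partial isometry that sends \<^term>\<open>ket w\<close> to \<^term>\<open>ket (f w)\<close>
  for \<open>w \<in> C\<close> and vanishes on the other basis vectors.  With \<open>f = id\<close> it is the projection onto the
  span of these vectors, in particular onto the Fock space if \<open>C\<close> is the carrier of a monoid.
\<close>

definition transport :: "'a set \<Rightarrow> ('a \<Rightarrow> 'b) \<Rightarrow> 'a ell2 \<Rightarrow>\<^sub>L 'b ell2" where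
  "transport C f = Blinfun (\<lambda>x. Abs_ell2 (\<lambda>u. if u \<in> f ` C then coeff x (inv_into C f u) else 0))"

lemma
  assumes inj: "inj_on f C"
  shows coeff_transport: "coeff (transport C f x) u = (if u \<in> f ` C then coeff x (inv_into C f u) else 0)"
    and norm_transport: "norm (transport C f x) \<le> norm x"
proof -
  let ?g = "\<lambda>x u. if u \<in> f ` C then coeff x (inv_into C f u) else 0"
  have *: "(\<lambda>u. (cmod (?g x u))\<^sup>2) summable_on UNIV \<and>
      (\<Sum>\<^sub>\<infinity>u. (cmod (?g x u))\<^sup>2) \<le> (\<Sum>\<^sub>\<infinity>u. (cmod (coeff x u))\<^sup>2)" for x
  proof -
    have comp: "((\<lambda>u. (cmod (?g x u))\<^sup>2) \<circ> f) w = (cmod (coeff x w))\<^sup>2" if "w \<in> C" for w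
      using inj that by simp
    have C: "(\<lambda>w. (cmod (coeff x w))\<^sup>2) summable_on C"
      using coeff_summable by (rule summable_on_subset_banach) simp
    then have "((\<lambda>u. (cmod (?g x u))\<^sup>2) \<circ> f) summable_on C"
      using comp by (subst summable_on_cong) auto
    then have "(\<lambda>u. (cmod (?g x u))\<^sup>2) summable_on f ` C"
      by (subst summable_on_reindex[OF inj])
    then have 1: "(\<lambda>u. (cmod (?g x u))\<^sup>2) summable_on UNIV"
      by (rule summable_on_cong_neutral[THEN iffD1, rotated -1]) auto
    have "(\<Sum>\<^sub>\<infinity>u. (cmod (?g x u))\<^sup>2) = (\<Sum>\<^sub>\<infinity>u\<in>f ` C. (cmod (?g x u))\<^sup>2)"
      by (rule infsum_cong_neutral) auto
    also have "\<dots> = infsum ((\<lambda>u. (cmod (?g x u))\<^sup>2) \<circ> f) C"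
      by (rule infsum_reindex[OF inj])
    also have "\<dots> = (\<Sum>\<^sub>\<infinity>w\<in>C. (cmod (coeff x w))\<^sup>2)"
      using comp by (rule infsum_cong)
    also have "\<dots> \<le> (\<Sum>\<^sub>\<infinity>w. (cmod (coeff x w))\<^sup>2)"
      by (intro infsum_mono_neutral C coeff_summable) auto
    finally show ?thesis
      using 1 by blast
  qed
  have g: "coeff (Abs_ell2 (?g x)) = ?g x" for x
    by (rule coeff_Abs) (use * in blast)
  have norm_g: "norm (Abs_ell2 (?g x)) \<le> norm x" for x
    using *[of x] by (simp add: norm_ell2_def g)
  have "bounded_linear (\<lambda>x. Abs_ell2 (?g x))"
  proof (rule bounded_linear_intro[where K = 1])
    show "norm (Abs_ell2 (?g x)) \<le> norm x * 1" for x
      using norm_g by simp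
  qed (rule ell2_eqI, simp only: g, simp add: g coeff_plus coeff_scaleR)+
  then have "transport C f x = Abs_ell2 (?g x)" for x
    by (simp add: transport_def bounded_linear_Blinfun_apply)
  then show "coeff (transport C f x) u = ?g x u" "norm (transport C f x) \<le> norm x"
    using norm_g by (simp_all add: g)
qed

lemma blinfun_compose_assoc: "(A o\<^sub>L B) o\<^sub>L C = A o\<^sub>L (B o\<^sub>L C)"
  by (rule blinfun_eqI) simp

lemmas blinfun_compose_bilinear =
  bounded_bilinear.add_left[OF bounded_bilinear_blinfun_compose]
  bounded_bilinear.add_right[OF bounded_bilinear_blinfun_compose]
  bounded_bilinear.zero_left[OF bounded_bilinear_blinfun_compose]
  bounded_bilinear.zero_right[OF bounded_bilinear_blinfun_compose]

lemma coeff_transport_id: "coeff (transport C id x) u = (if u \<in> C then coeff x u else 0)"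
  using inv_into_f_f[of id C u] by (simp add: coeff_transport)

text \<open>
  The elements of the algebra are operators on all of \<^typ>\<open>'a ell2\<close>; this makes precise that they live
  on the Fock space, which is what makes compression by partial isometries multiplicative.
\<close>

lemma toeplitz_supported:
  assumes "left_cancellative G" and "T \<in> toeplitz_algebra G"
  shows "transport (carrier G) id o\<^sub>L T = T" "T o\<^sub>L transport (carrier G) id = T"
proof -
  interpret monoid G
    by (rule left_cancellativeD(1)[OF assms(1)])
  note cancel = left_cancellativeD(2)[OF assms(1)]
  let ?P = "transport (carrier G) id"
  note P = coeff_transport_id[of "carrier G"]
  have "?P o\<^sub>L T = T \<and> T o\<^sub>L ?P = T"
    using assms(2)
  proof (rule toeplitz_algebra_induct)
    show "complex_subalgebra {T. ?P o\<^sub>L T = T \<and> T o\<^sub>L ?P = T}"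
    proof -
      have 1: "?P o\<^sub>L (cscale c o\<^sub>L T) = cscale c o\<^sub>L (?P o\<^sub>L T)" for c T
        by (rule blinfun_eqI, rule ell2_eqI) (simp add: P coeff_cscale)
      have 2: "(S o\<^sub>L T) o\<^sub>L ?P = S o\<^sub>L T" if "T o\<^sub>L ?P = T" for S T
        using that by (simp add: blinfun_compose_assoc)
      have 3: "?P o\<^sub>L (S o\<^sub>L T) = S o\<^sub>L T" if "?P o\<^sub>L S = S" for S T
        using that by (simp flip: blinfun_compose_assoc)
      show ?thesis
        unfolding complex_subalgebra_def by (simp add: blinfun_compose_bilinear 1 2 3)
    qed
    show "closed {T. ?P o\<^sub>L T = T \<and> T o\<^sub>L ?P = T}"
      by (intro closed_Collect_conj closed_Collect_eq continuous_intros)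
    fix v assume v: "v \<in> carrier G"
    have "?P o\<^sub>L creation G v = creation G v"
    proof (rule blinfun_eqI, rule ell2_eqI)
      fix x u
      have "(\<Sum>w | w \<in> carrier G \<and> v \<otimes>\<^bsub>G\<^esub> w = u. coeff x w) = 0" if "u \<notin> carrier G"
        using v that by (intro sum.neutral) auto
      then show "coeff ((?P o\<^sub>L creation G v) x) u = coeff (creation G v x) u"
        using v by (simp add: P coeff_creation cancel)
    qed
    moreover have "creation G v o\<^sub>L ?P = creation G v"
      using v by (intro blinfun_eqI ell2_eqI) (simp add: P coeff_creation cancel)
    ultimately show "?P o\<^sub>L creation G v = creation G v \<and> creation G v o\<^sub>L ?P = creation G v"
      by blast
  qed
  then show "?P o\<^sub>L T = T" "T o\<^sub>L ?P = T"
    by blast+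
qed

lemma coeff_transport_bij:
  assumes "bij_betw h C D" "\<forall>x\<in>C. k (h x) = x"
  shows "coeff (transport C h x) u = (if u \<in> D then coeff x (k u) else 0)"
proof -
  have "inj_on h C" "h ` C = D"
    using assms(1) by (simp_all add: bij_betw_def)
  moreover have "inv_into C h u = k u" if "u \<in> D"
    using assms \<open>h ` C = D\<close> that by (metis f_inv_into_f inv_into_into)
  ultimately show ?thesis
    by (simp add: coeff_transport)
qed

text \<open>
  Conjugation by the partial isometry of \<open>h\<close> sends the creation operator of \<open>v\<close> to that of \<open>h v\<close>.
  It is multiplicative on the algebra because the initial projection acts there as the identity.
\<close>

lemma toeplitz_transport:
  fixes G :: "'a monoid" and H :: "'b monoid"
  assumes G: "left_cancellative G"
    and H: "left_cancellative H"
    and h: "h \<in> hom G H" "bij_betw h (carrier G) (carrier H)"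
    and k: "bij_betw k (carrier H) (carrier G)" "\<forall>x\<in>carrier G. k (h x) = x" "\<forall>y\<in>carrier H. h (k y) = y"
    and T: "T \<in> toeplitz_algebra G"
  shows "transport (carrier G) h o\<^sub>L T o\<^sub>L transport (carrier H) k \<in> toeplitz_algebra H" (is "?U o\<^sub>L _ o\<^sub>L ?V \<in> _")
    and "transport (carrier H) k o\<^sub>L (transport (carrier G) h o\<^sub>L T o\<^sub>L transport (carrier H) k) o\<^sub>L
      transport (carrier G) h = T"
    and "norm (transport (carrier G) h o\<^sub>L T o\<^sub>L transport (carrier H) k) \<le> norm T"
proof -
  interpret G: monoid G
    by (rule left_cancellativeD(1)[OF G])
  interpret H: monoid H
    by (rule left_cancellativeD(1)[OF H])
  have cancel: "v \<in> carrier G \<Longrightarrow> inj_on (\<lambda>w. v \<otimes>\<^bsub>G\<^esub> w) (carrier G)"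
    "v' \<in> carrier H \<Longrightarrow> inj_on (\<lambda>w. v' \<otimes>\<^bsub>H\<^esub> w) (carrier H)" for v v'
    using G H by (simp_all add: left_cancellative_def)
  have in_H: "h x \<in> carrier H" if "x \<in> carrier G" for x
    using h(2) that by (auto simp: bij_betw_def)
  have in_G: "k y \<in> carrier G" if "y \<in> carrier H" for y
    using k(1) that by (auto simp: bij_betw_def)
  have U: "coeff (?U x) u = (if u \<in> carrier H then coeff x (k u) else 0)" for x u
    by (rule coeff_transport_bij[OF h(2) k(2)])
  have V: "coeff (?V y) u = (if u \<in> carrier G then coeff y (h u) else 0)" for y u
    by (rule coeff_transport_bij[OF k(1,3)])
  have VU: "?V o\<^sub>L ?U = transport (carrier G) id"
    by (intro blinfun_eqI ell2_eqI) (simp add: U V in_H k(2) coeff_transport_id)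
  have U_scale: "?U o\<^sub>L (cscale c o\<^sub>L S) = cscale c o\<^sub>L (?U o\<^sub>L S)" for c S
    by (intro blinfun_eqI ell2_eqI) (simp add: U coeff_cscale)
  note supported = toeplitz_supported[OF G]
  have "T \<in> toeplitz_algebra G \<and> ?U o\<^sub>L T o\<^sub>L ?V \<in> toeplitz_algebra H"
    using T
  proof (rule toeplitz_algebra_induct)
    have "?U o\<^sub>L (S o\<^sub>L T) o\<^sub>L ?V = (?U o\<^sub>L S o\<^sub>L ?V) o\<^sub>L (?U o\<^sub>L T o\<^sub>L ?V)"
      if "T \<in> toeplitz_algebra G" for S T
    proof -
      have "(?U o\<^sub>L S o\<^sub>L ?V) o\<^sub>L (?U o\<^sub>L T o\<^sub>L ?V) = ?U o\<^sub>L S o\<^sub>L ((?V o\<^sub>L ?U) o\<^sub>L T) o\<^sub>L ?V"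
        by (simp only: blinfun_compose_assoc)
      then show ?thesis
        by (simp only: VU supported(1)[OF that] blinfun_compose_assoc)
    qed
    moreover have "?U o\<^sub>L (cscale c o\<^sub>L T) o\<^sub>L ?V = cscale c o\<^sub>L (?U o\<^sub>L T o\<^sub>L ?V)" for c T
      by (simp only: U_scale blinfun_compose_assoc)
    ultimately show "complex_subalgebra {T. T \<in> toeplitz_algebra G \<and> ?U o\<^sub>L T o\<^sub>L ?V \<in> toeplitz_algebra H}"
      using complex_subalgebra_toeplitz[of G] complex_subalgebra_toeplitz[of H]
      unfolding complex_subalgebra_def by (simp add: blinfun_compose_bilinear)
    have "closed ((\<lambda>T. ?U o\<^sub>L T o\<^sub>L ?V) -` toeplitz_algebra H)"
      by (intro closed_vimage closed_toeplitz continuous_intros)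
    then have "closed (toeplitz_algebra G \<inter> (\<lambda>T. ?U o\<^sub>L T o\<^sub>L ?V) -` toeplitz_algebra H)"
      by (intro closed_Int closed_toeplitz)
    then show "closed {T. T \<in> toeplitz_algebra G \<and> ?U o\<^sub>L T o\<^sub>L ?V \<in> toeplitz_algebra H}"
      by (simp add: Collect_conj_eq vimage_def)
    fix v assume v: "v \<in> carrier G"
    have "?U o\<^sub>L creation G v o\<^sub>L ?V = creation H (h v)"
    proof (intro blinfun_eqI ell2_eqI)
      fix x u
      show "coeff ((?U o\<^sub>L creation G v o\<^sub>L ?V) x) u = coeff (creation H (h v) x) u"
      proof (cases "u \<in> carrier H")
        case True
        have "(\<Sum>w | w \<in> carrier G \<and> v \<otimes>\<^bsub>G\<^esub> w = k u. coeff x (h w)) =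
            (\<Sum>w | w \<in> carrier H \<and> h v \<otimes>\<^bsub>H\<^esub> w = u. coeff x w)"
        proof (rule sum.reindex_bij_witness[where i = k and j = h])
          fix w assume "w \<in> {w. w \<in> carrier G \<and> v \<otimes>\<^bsub>G\<^esub> w = k u}"
          then have w: "w \<in> carrier G" "v \<otimes>\<^bsub>G\<^esub> w = k u"
            by auto
          then have "h v \<otimes>\<^bsub>H\<^esub> h w = h (k u)"
            using h(1) v by (simp flip: hom_mult)
          then show "h w \<in> {w. w \<in> carrier H \<and> h v \<otimes>\<^bsub>H\<^esub> w = u}" "k (h w) = w"
            using True w by (simp_all add: in_H k)
        next
          fix w assume "w \<in> {w. w \<in> carrier H \<and> h v \<otimes>\<^bsub>H\<^esub> w = u}"
          then have w: "w \<in> carrier H" "h v \<otimes>\<^bsub>H\<^esub> w = u"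
            by auto
          then have "h (v \<otimes>\<^bsub>G\<^esub> k w) = u"
            using h(1) v by (simp add: hom_mult in_G k)
          then have "v \<otimes>\<^bsub>G\<^esub> k w = k u"
            using k(2) v w in_G G.m_closed[of v "k w"] by force
          then show "k w \<in> {w. w \<in> carrier G \<and> v \<otimes>\<^bsub>G\<^esub> w = k u}" "h (k w) = w"
            using w by (simp_all add: in_G k)
        qed simp
        then show ?thesis
          using True v by (simp add: U V coeff_creation cancel in_H)
      next
        case False
        then have "(\<Sum>w | w \<in> carrier H \<and> h v \<otimes>\<^bsub>H\<^esub> w = u. coeff x w) = 0"
          using in_H[OF v] by (intro sum.neutral) auto
        then show ?thesis
          using False v by (simp add: U coeff_creation cancel in_H)
      qed
    qed
    then show "creation G v \<in> toeplitz_algebra G \<and> ?U o\<^sub>L creation G v o\<^sub>L ?V \<in> toeplitz_algebra H"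
      using v in_H by (simp add: creation_in_toeplitz)
  qed
  then show "?U o\<^sub>L T o\<^sub>L ?V \<in> toeplitz_algebra H"
    by blast
  have "?V o\<^sub>L (?U o\<^sub>L T o\<^sub>L ?V) o\<^sub>L ?U = (?V o\<^sub>L ?U) o\<^sub>L T o\<^sub>L (?V o\<^sub>L ?U)"
    by (simp only: blinfun_compose_assoc)
  then show "?V o\<^sub>L (?U o\<^sub>L T o\<^sub>L ?V) o\<^sub>L ?U = T"
    by (simp only: VU supported[OF T])
  have "norm ?U \<le> 1" "norm ?V \<le> 1"
    using h(2) k(1) by (auto simp: bij_betw_def intro!: norm_blinfun_bound norm_transport)
  then have "norm ?U * norm T * norm ?V \<le> 1 * norm T * 1"
    by (intro mult_mono) auto
  moreover have "norm (?U o\<^sub>L T o\<^sub>L ?V) \<le> norm ?U * norm T * norm ?V"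
    by (meson norm_blinfun_compose order_trans mult_right_mono norm_ge_zero)
  ultimately show "norm (?U o\<^sub>L T o\<^sub>L ?V) \<le> norm T"
    by simp
qed

lemma monoid_iso_imp_isometrically_isomorphic:
  fixes G :: "'a monoid" and H :: "'b monoid"
  assumes G: "left_cancellative G"
    and H: "left_cancellative H"
    and "G \<cong> H"
  shows "isometrically_isomorphic (toeplitz_algebra G) (toeplitz_algebra H)"
proof -
  obtain h where hom: "h \<in> hom G H" and bij: "bij_betw h (carrier G) (carrier H)"
    using assms(3) by (auto simp: is_iso_def iso_def)
  define k where "k = inv_into (carrier G) h"
  have kh: "\<forall>x\<in>carrier G. k (h x) = x"
    using bij by (simp add: k_def bij_betw_def)
  have hk: "\<forall>y\<in>carrier H. h (k y) = y"
    using bij by (auto simp: k_def bij_betw_def f_inv_into_f)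
  have bij': "bij_betw k (carrier H) (carrier G)"
    unfolding k_def by (rule bij_betw_inv_into[OF bij])
  have hom': "k \<in> hom H G"
  proof (rule homI)
    fix x y assume xy: "x \<in> carrier H" "y \<in> carrier H"
    then have k_in: "k x \<in> carrier G" "k y \<in> carrier G"
      using bij' by (auto simp: bij_betw_def)
    then have "h (k x \<otimes>\<^bsub>G\<^esub> k y) = x \<otimes>\<^bsub>H\<^esub> y"
      using hom xy by (simp add: hom_mult hk)
    then show "k (x \<otimes>\<^bsub>H\<^esub> y) = k x \<otimes>\<^bsub>G\<^esub> k y"
      using kh monoid.m_closed[OF left_cancellativeD(1)[OF G] k_in] by force
  qed (use bij' in \<open>auto simp: bij_betw_def\<close>)
  let ?U = "transport (carrier G) h" and ?V = "transport (carrier H) k"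
  let ?\<phi> = "\<lambda>T. ?U o\<^sub>L T o\<^sub>L ?V" and ?\<psi> = "\<lambda>T. ?V o\<^sub>L T o\<^sub>L ?U"
  note fwd = toeplitz_transport[OF G H hom bij bij' kh hk]
  note bwd = toeplitz_transport[OF H G hom' bij' bij hk kh]
  have VU: "?V o\<^sub>L (?U o\<^sub>L (T o\<^sub>L X)) = T o\<^sub>L X" if "T \<in> toeplitz_algebra G" for T and X :: "'b ell2 \<Rightarrow>\<^sub>L 'a ell2"
  proof -
    have "h x \<in> carrier H" if "x \<in> carrier G" for x
      using bij that by (auto simp: bij_betw_def)
    then have "?V o\<^sub>L ?U = transport (carrier G) id"
      by (intro blinfun_eqI ell2_eqI) (simp add: coeff_transport_bij[OF bij' hk]
          coeff_transport_bij[OF bij kh] kh coeff_transport_id)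
    then have "(?V o\<^sub>L ?U) o\<^sub>L T = T"
      using toeplitz_supported(1)[OF G that] by simp
    then show ?thesis
      by (simp flip: blinfun_compose_assoc)
  qed
  have "bij_betw ?\<phi> (toeplitz_algebra G) (toeplitz_algebra H)"
    by (rule bij_betw_byWitness[of _ ?\<psi>]) (use fwd bwd in auto)
  moreover have "?\<phi> (S o\<^sub>L T) = ?\<phi> S o\<^sub>L ?\<phi> T" if "T \<in> toeplitz_algebra G" for S T
    by (simp only: VU[OF that] blinfun_compose_assoc)
  moreover have "?\<phi> (cscale c o\<^sub>L T) = cscale c o\<^sub>L ?\<phi> T" for c T
    by (intro blinfun_eqI ell2_eqI) (simp add: coeff_transport_bij[OF bij kh] coeff_cscale)
  moreover have "norm (?\<phi> T) = norm T" if "T \<in> toeplitz_algebra G" for T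
    using fwd(2,3)[OF that] bwd(3)[OF fwd(1)[OF that]] by simp
  ultimately show ?thesis
    unfolding isometrically_isomorphic_def
    by (intro exI[of _ ?\<phi>]) (simp add: blinfun_compose_bilinear)
qed

section \<open>Product conjugate permutations\<close>

definition product_conjugate :: "('n \<times> 'm \<Rightarrow> 'n \<times> 'm) \<Rightarrow> ('n \<times> 'm \<Rightarrow> 'n \<times> 'm) \<Rightarrow> bool" where
  "product_conjugate \<theta>1 \<theta>2 \<longleftrightarrow>
    (\<exists>\<sigma> \<tau>. bij \<sigma> \<and> bij \<tau> \<and> (\<forall>x. \<theta>2 (map_prod \<sigma> \<tau> x) = map_prod \<sigma> \<tau> (\<theta>1 x)))"

lemma product_conjugate_sym:
  assumes "product_conjugate \<theta>1 \<theta>2"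
  shows "product_conjugate \<theta>2 \<theta>1"
proof -
  obtain \<sigma> \<tau> where bij: "bij \<sigma>" "bij \<tau>"
    and conj: "\<And>x. \<theta>2 (map_prod \<sigma> \<tau> x) = map_prod \<sigma> \<tau> (\<theta>1 x)"
    using assms by (auto simp: product_conjugate_def)
  define \<sigma>' where "\<sigma>' = inv_into UNIV \<sigma>"
  define \<tau>' where "\<tau>' = inv_into UNIV \<tau>"
  have bij': "bij \<sigma>'" "bij \<tau>'"
    using bij by (simp_all add: \<sigma>'_def \<tau>'_def bij_imp_bij_inv)
  have inv: "map_prod \<sigma> \<tau> (map_prod \<sigma>' \<tau>' x) = x" "map_prod \<sigma>' \<tau>' (map_prod \<sigma> \<tau> x) = x" for x
    using bij by (cases x; simp add: \<sigma>'_def \<tau>'_def bij_is_surj surj_f_inv_f bij_is_inj inv_f_f)+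
  have "\<theta>1 (map_prod \<sigma>' \<tau>' x) = map_prod \<sigma>' \<tau>' (\<theta>2 x)" for x
    using conj[of "map_prod \<sigma>' \<tau>' x"] inv by metis
  then show ?thesis
    unfolding product_conjugate_def using bij' by blast
qed

lemma product_conjugate_imp_two_graph_iso:
  "product_conjugate \<theta>1 \<theta>2 \<Longrightarrow> two_graph \<theta>1 \<cong> two_graph \<theta>2"
  unfolding product_conjugate_def by (metis map_prod_simp product_conjugate_imp_iso)

lemma product_conjugate_link_count:
  assumes "product_conjugate \<theta>1 \<theta>2"
    and RS: "R \<in> {same_row, same_column}" "S \<in> {same_row, same_column}"
  shows "link_count R a S b \<theta>1 = link_count R a S b \<theta>2"
proof -
  obtain \<sigma> \<tau> where bij: "bij \<sigma>" "bij \<tau>"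
    and conj: "\<And>x. \<theta>2 (map_prod \<sigma> \<tau> x) = map_prod \<sigma> \<tau> (\<theta>1 x)"
    using assms by (auto simp: product_conjugate_def)
  define g where "g = map_prod \<sigma> \<tau>"
  have pow: "(\<theta>2 ^^ n) (g x) = g ((\<theta>1 ^^ n) x)" for n x
    by (induction n) (simp_all add: conj g_def)
  have rel: "T (g x) (g y) = T x y" if "T = same_row \<or> T = same_column" for T x y
    using that bij by (cases x; cases y) (auto simp: g_def same_row_def same_column_def bij_is_inj inj_eq)
  have T: "R = same_row \<or> R = same_column" "S = same_row \<or> S = same_column"
    using RS by simp_all
  have bijg: "bij g"
    unfolding g_def using bij by (metis bij_betw_map_prod UNIV_Times_UNIV)
  have "bij_betw (map_prod g g) {(x, y). R x ((\<theta>1 ^^ a) y) \<and> S y ((\<theta>1 ^^ b) x)}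
      {(x, y). R x ((\<theta>2 ^^ a) y) \<and> S y ((\<theta>2 ^^ b) x)}"
  proof (rule bij_betw_imageI)
    show "inj_on (map_prod g g) {(x, y). R x ((\<theta>1 ^^ a) y) \<and> S y ((\<theta>1 ^^ b) x)}"
      using bijg by (meson bij_is_inj inj_on_subset prod.inj_map subset_UNIV)
    have "(x, y) \<in> map_prod g g ` {(x, y). R x ((\<theta>1 ^^ a) y) \<and> S y ((\<theta>1 ^^ b) x)}"
      if "R x ((\<theta>2 ^^ a) y)" "S y ((\<theta>2 ^^ b) x)" for x y
    proof -
      obtain x' y' where "x = g x'" "y = g y'"
        using bijg by (metis bij_pointE)
      then show ?thesis
        using that by (auto simp: pow rel[OF T(1)] rel[OF T(2)] intro!: rev_image_eqI[of "(x', y')"])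
    qed
    then show "map_prod g g ` {(x, y). R x ((\<theta>1 ^^ a) y) \<and> S y ((\<theta>1 ^^ b) x)} =
        {(x, y). R x ((\<theta>2 ^^ a) y) \<and> S y ((\<theta>2 ^^ b) x)}"
      by (auto simp: pow rel[OF T(1)] rel[OF T(2)])
  qed
  then show ?thesis
    unfolding link_count_def by (rule bij_betw_same_card)
qed

section \<open>Tables of permutations of the 2 by 3 rectangle\<close>

text \<open>
  A permutation of the cells is tabulated as the list of the numbers of the images of the cells
  \<open>1, \<dots>, 6\<close>.
\<close>

definition entry :: "nat list \<Rightarrow> nat \<Rightarrow> nat" where
  "entry p k = p ! (k - 1)"

definition cell_numbers :: "nat list" where
  "cell_numbers = [1, 2, 3, 4, 5, 6]"

definition rectangles :: "nat list list" where
  "rectangles = [[1], [2], [3], [4], [5], [6], [1,2], [1,3], [2,3], [4,5], [4,6], [5,6], [1,2,3], [4,5,6],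
     [1,4], [2,5], [3,6], [1,2,4,5], [1,3,4,6], [2,3,5,6]]"

text \<open>
  The permutations of the cells that are induced by row and column permutations.
\<close>

definition relabellings :: "nat list list" where
  "relabellings =
    [[1,2,3,4,5,6], [1,3,2,4,6,5], [2,1,3,5,4,6], [2,3,1,5,6,4], [3,1,2,6,4,5], [3,2,1,6,5,4],
     [4,5,6,1,2,3], [4,6,5,1,3,2], [5,4,6,2,1,3], [5,6,4,2,3,1], [6,4,5,3,1,2], [6,5,4,3,2,1]]"

definition representative_cycles :: "nat list list" where
  "representative_cycles =
    [[1,5,3,4,2,6], [1,4,2,5,3,6], [1,5,3,6,2,4], [1,2,3,6,5,4], [1,4,2,5,6,3],
     [1,2,5,4,3,6], [1,2,3,4,5,6], [1,2,3,4,6,5], [1,2,4,5,3,6], [1,2,4,5,6,3],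
     [1,5,4,2,3,6], [1,2,4,6,5,3], [1,5,4,2,6,3], [1,2,6,4,3,5]]"

definition cycle_table :: "nat list \<Rightarrow> nat list" where
  "cycle_table cs = map (cycle_of_list cs) cell_numbers"

text \<open>
  The remaining permutations, up to product conjugacy, that leave no proper subrectangle invariant:
  they have cycle types \<open>(3, 3)\<close>, \<open>(4, 2)\<close> and \<open>(2, 2, 2)\<close>.
\<close>

definition intransitive_representatives :: "nat list list" where
  "intransitive_representatives =
    [[2,4,5,1,6,3], [2,4,5,6,3,1], [2,4,6,1,3,5], [2,5,4,3,6,1], [2,5,4,6,1,3],
     [2,6,4,3,1,5], [2,6,4,5,3,1], [2,6,5,3,4,1], [4,6,5,2,3,1], [5,6,4,3,1,2]]"

definition representatives :: "nat list list" where
  "representatives = map cycle_table representative_cycles @ intransitive_representatives"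

definition preserves_rectangle :: "nat list \<Rightarrow> bool" where
  "preserves_rectangle p \<longleftrightarrow> list_ex (\<lambda>r. list_all (\<lambda>k. entry p k \<in> set r) r) rectangles"

definition relabelled :: "nat list \<Rightarrow> nat list \<Rightarrow> bool" where
  "relabelled p q \<longleftrightarrow> list_ex (\<lambda>g. list_all (\<lambda>k. entry q (entry g k) = entry g (entry p k)) cell_numbers) relabellings"

definition same_row_number :: "nat \<Rightarrow> nat \<Rightarrow> bool" where
  "same_row_number k l \<longleftrightarrow> (k \<le> 3 \<longleftrightarrow> l \<le> 3)"

definition same_column_number :: "nat \<Rightarrow> nat \<Rightarrow> bool" where
  "same_column_number k l \<longleftrightarrow> entry [1,2,3,1,2,3] k = entry [1,2,3,1,2,3] l"

definition list_link_count ::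
  "(nat \<Rightarrow> nat \<Rightarrow> bool) \<Rightarrow> nat \<Rightarrow> (nat \<Rightarrow> nat \<Rightarrow> bool) \<Rightarrow> nat \<Rightarrow> nat list \<Rightarrow> nat" where
  "list_link_count R a S b p = length (filter (\<lambda>(k, l). R k ((entry p ^^ a) l) \<and> S l ((entry p ^^ b) k))
     (List.product cell_numbers cell_numbers))"

text \<open>
  The choice of the six words is empirical: they separate the representatives with exponents that
  do not exceed three.
\<close>

definition signature :: "nat list \<Rightarrow> nat list" where
  "signature p =
    [list_link_count same_column_number 1 same_column_number 3 p,
     list_link_count same_row_number 2 same_row_number 3 p,
     list_link_count same_column_number 2 same_row_number 2 p,
     list_link_count same_row_number 1 same_column_number 2 p,
     list_link_count same_row_number 2 same_column_number 3 p,
     list_link_count same_column_number 2 same_column_number 2 p]"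

lemma distinct_signatures: "distinct (map signature representatives)"
  by code_simp

text \<open>
  The exhaustive part of the classification: it runs through the permutations of the six cells that
  leave no proper subrectangle invariant.
\<close>

lemma relabelled_to_representative:
  "list_all (\<lambda>p. list_ex (relabelled p) representatives)
    (filter (\<lambda>p. \<not> preserves_rectangle p) (permutations_of_set_list cell_numbers))"
  by code_simp

section \<open>Cells and their numbers\<close>

lemma cell_simps:
  "cell 1 = (1, 1)" "cell 2 = (1, 2)" "cell 3 = (1, 3)" "cell 4 = (2, 1)" "cell 5 = (2, 2)" "cell 6 = (2, 3)"
  by (simp_all add: cell_def)

lemma cell_surj: "cell ` set cell_numbers = UNIV"
proof -
  have "c \<in> cell ` set cell_numbers" for c
  proof (cases c)
    case (Pair i j)
    then show ?thesis
      using exhaust_2[of i] exhaust_3[of j]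
      by (auto simp: cell_numbers_def cell_simps simp del: One_nat_def)
  qed
  then show ?thesis by blast
qed

lemma inj_on_cell: "inj_on cell (set cell_numbers)"
  by (rule eq_card_imp_inj_on) (simp_all add: cell_surj, simp add: cell_numbers_def)

definition cell_number :: "2 \<times> 3 \<Rightarrow> nat" where
  "cell_number = inv_into (set cell_numbers) cell"

lemma cell_cell_number: "cell (cell_number c) = c"
  by (simp add: cell_number_def f_inv_into_f cell_surj)

lemma cell_number_in: "cell_number c \<in> set cell_numbers"
  by (simp add: cell_number_def inv_into_into cell_surj)

lemma cell_number_cell: "k \<in> set cell_numbers \<Longrightarrow> cell_number (cell k) = k"
  by (simp add: cell_number_def inv_into_f_f inj_on_cell)

definition map_of_table :: "nat list \<Rightarrow> 2 \<times> 3 \<Rightarrow> 2 \<times> 3" where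
  "map_of_table p c = cell (entry p (cell_number c))"

definition table_of_map :: "(2 \<times> 3 \<Rightarrow> 2 \<times> 3) \<Rightarrow> nat list" where
  "table_of_map \<theta> = map (\<lambda>k. cell_number (\<theta> (cell k))) cell_numbers"

lemma map_of_table_cell: "k \<in> set cell_numbers \<Longrightarrow> map_of_table p (cell k) = cell (entry p k)"
  by (simp add: map_of_table_def cell_number_cell)

lemma entry_map: "k \<in> set cell_numbers \<Longrightarrow> entry (map f cell_numbers) k = f k"
  by (auto simp: entry_def cell_numbers_def)

lemma map_of_table_of_map: "map_of_table (table_of_map \<theta>) = \<theta>"
  by (rule ext) (simp add: map_of_table_def table_of_map_def entry_map cell_number_in cell_cell_number)

lemma table_of_map_permutation:
  assumes "bij \<theta>"
  shows "table_of_map \<theta> \<in> permutations_of_set (set cell_numbers)"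
proof (rule permutations_of_setI)
  have inj: "inj_on (\<lambda>k. cell_number (\<theta> (cell k))) (set cell_numbers)"
    by (rule inj_onI) (metis assms bij_is_inj cell_cell_number inj_eq inj_on_cell inj_onD)
  then show "distinct (table_of_map \<theta>)"
    by (simp add: table_of_map_def distinct_map) (simp add: cell_numbers_def)
  have "(\<lambda>k. cell_number (\<theta> (cell k))) ` set cell_numbers \<subseteq> set cell_numbers"
    using cell_number_in by blast
  then show "set (table_of_map \<theta>) = set cell_numbers"
    unfolding table_of_map_def set_map by (rule endo_inj_surj[OF finite_set _ inj])
qed

definition link_invariants :: "('n \<times> 'm \<Rightarrow> 'n \<times> 'm) \<Rightarrow> nat list" where
  "link_invariants \<theta> =
    [link_count same_column 1 same_column 3 \<theta>,
     link_count same_row 2 same_row 3 \<theta>,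
     link_count same_column 2 same_row 2 \<theta>,
     link_count same_row 1 same_column 2 \<theta>,
     link_count same_row 2 same_column 3 \<theta>,
     link_count same_column 2 same_column 2 \<theta>]"

lemma link_count_map_of_table:
  assumes p: "\<And>k. k \<in> set cell_numbers \<Longrightarrow> entry p k \<in> set cell_numbers"
    and R: "\<And>k l. k \<in> set cell_numbers \<Longrightarrow> l \<in> set cell_numbers \<Longrightarrow> R (cell k) (cell l) \<longleftrightarrow> R' k l"
    and S: "\<And>k l. k \<in> set cell_numbers \<Longrightarrow> l \<in> set cell_numbers \<Longrightarrow> S (cell k) (cell l) \<longleftrightarrow> S' k l"
  shows "link_count R a S b (map_of_table p) = list_link_count R' a S' b p"
proof -
  have pow: "(map_of_table p ^^ n) (cell k) = cell ((entry p ^^ n) k) \<and> (entry p ^^ n) k \<in> set cell_numbers"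
    if "k \<in> set cell_numbers" for n k
    using that by (induction n) (simp_all add: map_of_table_cell p)
  let ?F = "filter (\<lambda>(k, l). R' k ((entry p ^^ a) l) \<and> S' l ((entry p ^^ b) k))
    (List.product cell_numbers cell_numbers)"
  have "{(x, y). R x ((map_of_table p ^^ a) y) \<and> S y ((map_of_table p ^^ b) x)} = map_prod cell cell ` set ?F"
  proof (rule Set.set_eqI)
    fix z
    obtain k l where z: "z = (cell k, cell l)" and kl: "k \<in> set cell_numbers" "l \<in> set cell_numbers"
      by (metis cell_cell_number cell_number_in surj_pair)
    have "z \<in> map_prod cell cell ` set ?F \<longleftrightarrow> (k, l) \<in> set ?F"
      using kl by (auto simp: z inj_on_eq_iff[OF inj_on_cell] intro!: rev_image_eqI[of "(k, l)"])
    then show "z \<in> {(x, y). R x ((map_of_table p ^^ a) y) \<and> S y ((map_of_table p ^^ b) x)} \<longleftrightarrow>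
        z \<in> map_prod cell cell ` set ?F"
      using kl by (simp add: z pow R S)
  qed
  then have "link_count R a S b (map_of_table p) = card (map_prod cell cell ` set ?F)"
    by (simp only: link_count_def)
  also have "\<dots> = card (set ?F)"
    by (intro card_image inj_on_subset[OF map_prod_inj_on[OF inj_on_cell inj_on_cell]]) auto
  also have "\<dots> = length ?F"
    by (intro distinct_card distinct_filter distinct_product) (simp_all add: cell_numbers_def)
  finally show ?thesis
    by (simp add: list_link_count_def)
qed

lemma same_row_cell:
  "k \<in> set cell_numbers \<Longrightarrow> l \<in> set cell_numbers \<Longrightarrow> same_row (cell k) (cell l) \<longleftrightarrow> same_row_number k l"
  unfolding cell_numbers_def
  by (auto simp: same_row_def same_row_number_def cell_simps simp del: One_nat_def)

lemma same_column_cell: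
  "k \<in> set cell_numbers \<Longrightarrow> l \<in> set cell_numbers \<Longrightarrow> same_column (cell k) (cell l) \<longleftrightarrow> same_column_number k l"
  unfolding cell_numbers_def
  by (auto simp: same_column_def same_column_number_def entry_def cell_simps simp del: One_nat_def)

lemma link_invariants_map_of_table:
  assumes "\<And>k. k \<in> set cell_numbers \<Longrightarrow> entry p k \<in> set cell_numbers"
  shows "link_invariants (map_of_table p) = signature p"
  unfolding link_invariants_def signature_def list.inject
  by (intro conjI HOL.refl link_count_map_of_table assms same_row_cell same_column_cell)

section \<open>Conjugation to a representative\<close>

lemma relabelling_product:
  assumes "g \<in> set relabellings"
  obtains \<sigma> \<tau> where "bij \<sigma>" "bij \<tau>" "\<And>k. k \<in> set cell_numbers \<Longrightarrow> map_prod \<sigma> \<tau> (cell k) = cell (entry g k)"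
proof -
  define P where "P g \<longleftrightarrow> (\<exists>\<sigma> \<tau>. bij \<sigma> \<and> bij \<tau> \<and> (\<forall>k\<in>set cell_numbers. map_prod \<sigma> \<tau> (cell k) = cell (entry g k)))" for g
  have I: "P g" if "bij \<sigma>" "bij \<tau>" "list_all (\<lambda>k. map_prod \<sigma> \<tau> (cell k) = cell (entry g k)) cell_numbers" for \<sigma> \<tau> g
    using that by (auto simp: P_def list_all_iff)
  note simps = cell_numbers_def entry_def cell_simps Transposition.transpose_def
  let ?r = "Transposition.transpose 1 2 :: 2 \<Rightarrow> 2" and ?a = "Transposition.transpose 1 2 :: 3 \<Rightarrow> 3" and ?b = "Transposition.transpose 2 3 :: 3 \<Rightarrow> 3"
  have "P [1,2,3,4,5,6]" by (rule I[of id id]) (simp_all add: simps del: One_nat_def)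
  moreover have "P [1,3,2,4,6,5]" by (rule I[of id ?b]) (simp_all add: simps del: One_nat_def)
  moreover have "P [2,1,3,5,4,6]" by (rule I[of id ?a]) (simp_all add: simps del: One_nat_def)
  moreover have "P [2,3,1,5,6,4]" by (rule I[of id "?a \<circ> ?b"]) (simp_all add: simps bij_comp del: One_nat_def)
  moreover have "P [3,1,2,6,4,5]" by (rule I[of id "?b \<circ> ?a"]) (simp_all add: simps bij_comp del: One_nat_def)
  moreover have "P [3,2,1,6,5,4]" by (rule I[of id "Transposition.transpose 1 3"]) (simp_all add: simps del: One_nat_def)
  moreover have "P [4,5,6,1,2,3]" by (rule I[of ?r id]) (simp_all add: simps del: One_nat_def)
  moreover have "P [4,6,5,1,3,2]" by (rule I[of ?r ?b]) (simp_all add: simps del: One_nat_def)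
  moreover have "P [5,4,6,2,1,3]" by (rule I[of ?r ?a]) (simp_all add: simps del: One_nat_def)
  moreover have "P [5,6,4,2,3,1]" by (rule I[of ?r "?a \<circ> ?b"]) (simp_all add: simps bij_comp del: One_nat_def)
  moreover have "P [6,4,5,3,1,2]" by (rule I[of ?r "?b \<circ> ?a"]) (simp_all add: simps bij_comp del: One_nat_def)
  moreover have "P [6,5,4,3,2,1]" by (rule I[of ?r "Transposition.transpose 1 3"]) (simp_all add: simps del: One_nat_def)
  ultimately have "list_all P relabellings"
    by (simp only: relabellings_def list.pred_inject simp_thms)
  then have "P g"
    using assms by (simp only: list_all_iff)
  then show thesis
    using that by (auto simp: P_def)
qed

lemma permutation_table_closed:
  assumes "p \<in> permutations_of_set (set cell_numbers)" "k \<in> set cell_numbers"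
  shows "entry p k \<in> set cell_numbers"
proof -
  have "length p = 6"
    using permutations_of_setD[OF assms(1)] distinct_card[of p] by (simp add: cell_numbers_def)
  moreover have "k - 1 < 6"
    using assms(2) by (auto simp: cell_numbers_def)
  ultimately show ?thesis
    using permutations_of_setD(1)[OF assms(1)] by (metis entry_def nth_mem)
qed

lemma relabelled_imp_product_conjugate:
  assumes p: "\<And>k. k \<in> set cell_numbers \<Longrightarrow> entry p k \<in> set cell_numbers"
    and "relabelled p q"
  shows "product_conjugate (map_of_table p) (map_of_table q)"
proof -
  obtain g where g: "g \<in> set relabellings"
    and conj: "\<And>k. k \<in> set cell_numbers \<Longrightarrow> entry q (entry g k) = entry g (entry p k)"
    using assms(2) by (auto simp: relabelled_def list_ex_iff list_all_iff)
  obtain \<sigma> \<tau> where bij: "bij \<sigma>" "bij \<tau>"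
    and \<sigma>\<tau>: "\<And>k. k \<in> set cell_numbers \<Longrightarrow> map_prod \<sigma> \<tau> (cell k) = cell (entry g k)"
    using relabelling_product[OF g] by metis
  have closed: "entry g k \<in> set cell_numbers" if "k \<in> set cell_numbers" for k
    using g that unfolding relabellings_def cell_numbers_def
    by (auto simp: entry_def)
  have "map_of_table q (map_prod \<sigma> \<tau> x) = map_prod \<sigma> \<tau> (map_of_table p x)" for x
  proof -
    let ?k = "cell_number x"
    have k: "?k \<in> set cell_numbers"
      by (rule cell_number_in)
    have "map_of_table q (map_prod \<sigma> \<tau> (cell ?k)) = map_prod \<sigma> \<tau> (map_of_table p (cell ?k))"
      using k by (simp only: \<sigma>\<tau> map_of_table_cell closed p conj)
    then show ?thesis
      by (simp only: cell_cell_number)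
  qed
  then show ?thesis
    using bij unfolding product_conjugate_def by blast
qed

lemma rectangles_product:
  "r \<in> set rectangles \<Longrightarrow> cell ` set r = fst ` cell ` set r \<times> snd ` cell ` set r"
proof -
  have "list_all (\<lambda>r. cell ` set r = fst ` cell ` set r \<times> snd ` cell ` set r) rectangles"
    unfolding rectangles_def by (simp add: cell_simps insert_Times_insert del: One_nat_def) auto
  then show "r \<in> set rectangles \<Longrightarrow> ?thesis"
    by (simp add: list_all_iff)
qed

text \<open>
  An invariant rectangle is the support of a rank one matrix whose entries are \<open>0\<close> and \<open>1\<close>.  Its two
  factors are nonzero and solve the equations of the Gelfand space, and for a proper rectangle one
  of them is not constant.
\<close>

lemma minimal_type_no_rectangle:
  assumes "bij \<theta>" "minimal_type \<theta>"
  shows "\<not> preserves_rectangle (table_of_map \<theta>)"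
proof
  assume "preserves_rectangle (table_of_map \<theta>)"
  then obtain r where r: "r \<in> set rectangles" and inv: "\<And>k. k \<in> set r \<Longrightarrow> entry (table_of_map \<theta>) k \<in> set r"
    by (auto simp: preserves_rectangle_def list_ex_iff list_all_iff)
  define X where "X = cell ` set r"
  define z :: "2 \<Rightarrow> complex" where "z i = (if i \<in> fst ` X then 1 else 0)" for i
  define w :: "3 \<Rightarrow> complex" where "w j = (if j \<in> snd ` X then 1 else 0)" for j
  have zw: "z i * w j = (if (i, j) \<in> X then 1 else 0)" for i j
    using rectangles_product[OF r] by (auto simp: z_def w_def X_def)
  have r_sub: "set r \<subseteq> set cell_numbers" and r_card: "length r \<le> 4" "r \<noteq> []"
    using r by (auto simp: rectangles_def cell_numbers_def)
  have "\<theta> (cell k) \<in> X" if "k \<in> set r" for k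
  proof -
    have "\<theta> (cell k) = cell (entry (table_of_map \<theta>) k)"
      using that r_sub by (metis map_of_table_cell map_of_table_of_map subset_iff)
    then show ?thesis
      using inv[OF that] by (simp add: X_def)
  qed
  then have "\<theta> ` X \<subseteq> X"
    by (auto simp: X_def)
  then have "\<theta> ` X = X"
    using assms(1) by (intro endo_inj_surj) (auto simp: X_def bij_def intro: inj_on_subset[OF _ subset_UNIV])
  then have mem: "\<theta> x \<in> X \<longleftrightarrow> x \<in> X" for x
    using assms(1) by (metis bij_is_inj inj_image_mem_iff)
  have "z i * w j = z i' * w j'" if "\<theta> (i, j) = (i', j')" for i j i' j'
    using mem[of "(i, j)"] that by (simp add: zw)
  then have "(\<forall>i. z i = 0) \<or> (\<forall>j. w j = 0) \<or> ((\<forall>i i'. z i = z i') \<and> (\<forall>j j'. w j = w j'))"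
    by (rule minimal_type_products[OF assms(2)])
  moreover obtain i0 j0 where 0: "(i0, j0) \<in> X"
  proof -
    have "cell (hd r) \<in> X"
      using r_card(2) by (simp add: X_def)
    then show thesis
      using that by (metis surj_pair)
  qed
  then have ij0: "z i0 = 1" "w j0 = 1"
    by (force simp: z_def w_def)+
  ultimately have "\<forall>i. z i = z i0" "\<forall>j. w j = w j0"
    by (metis zero_neq_one)+
  then have "z i * w j = 1" for i j
    using ij0 by simp
  then have "X = UNIV"
    using zw by (auto split: if_splits) (metis zero_neq_one)
  moreover have "card X \<le> 4"
    unfolding X_def using card_image_le[of "set r" cell] card_length[of r] r_card(1) by simp
  ultimately show False
    by simp
qed

lemma conjugate_to_representative:
  assumes "bij \<theta>" "minimal_type \<theta>"
  obtains q where "q \<in> set representatives" "product_conjugate \<theta> (map_of_table q)"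
proof -
  let ?p = "table_of_map \<theta>"
  have p: "?p \<in> permutations_of_set (set cell_numbers)"
    by (rule table_of_map_permutation[OF assms(1)])
  also have "\<dots> = set (permutations_of_set_list cell_numbers)"
    using permutations_of_list[of cell_numbers] by (simp add: cell_numbers_def)
  finally have "list_ex (relabelled ?p) representatives"
    using relabelled_to_representative minimal_type_no_rectangle[OF assms] by (simp add: list_all_iff)
  then obtain q where q: "q \<in> set representatives" "relabelled ?p q"
    by (auto simp: list_ex_iff)
  have "product_conjugate (map_of_table ?p) (map_of_table q)"
    using permutation_table_closed[OF p] q(2) by (rule relabelled_imp_product_conjugate)
  then show thesis
    using that q(1) by (simp add: map_of_table_of_map)
qed

lemma cyclic_type_bij:
  assumes "cyclic_type \<theta>"
  shows "bij \<theta>"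
  using assms permutation_bijective[OF permutation_of_cycle] by (auto simp: cyclic_type_def)

lemma cyclic_type_transitive:
  assumes "cyclic_type \<theta>" "x \<in> S" "\<And>y. y \<in> S \<Longrightarrow> \<theta> y \<in> S"
  shows "S = UNIV"
proof -
  obtain cs where cs: "distinct cs" "set cs = UNIV" "\<theta> = cycle_of_list cs"
    using assms(1) by (auto simp: cyclic_type_def)
  obtain i where i: "i < length cs" "cs ! i = x"
    using cs(2) by (metis UNIV_I in_set_conv_nth)
  have pow: "(\<theta> ^^ n) x \<in> S" for n
    by (induction n) (simp_all add: assms)
  have "y \<in> S" for y
  proof -
    obtain j where j: "j < length cs" "cs ! j = y"
      using cs(2) by (metis UNIV_I in_set_conv_nth)
    let ?n = "j + length cs - i"
    have "(\<theta> ^^ ?n) x = map (\<theta> ^^ ?n) cs ! i"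
      using i by simp
    also have "\<dots> = rotate ?n cs ! i"
      using cyclic_rotation[OF cs(1), of ?n] cs(3) by simp
    also have "\<dots> = y"
      using i j by (simp add: nth_rotate)
    finally show ?thesis
      using pow by metis
  qed
  then show ?thesis by blast
qed

text \<open>
  Along the single cycle all products \<open>z\<^sub>i w\<^sub>j\<close> are equal.
\<close>

lemma cyclic_type_imp_minimal_type:
  fixes \<theta> :: "'n::finite \<times> 'm::finite \<Rightarrow> 'n \<times> 'm"
  assumes "cyclic_type \<theta>"
  shows "minimal_type \<theta>"
  unfolding minimal_type_def
proof (intro equalityI subsetI)
  fix zw assume zw: "zw \<in> gelfand_space \<theta>"
  obtain z w where zw_eq: "zw = (z, w)"
    by fastforce
  have rel: "z $ fst (\<theta> y) * w $ snd (\<theta> y) = z $ fst y * w $ snd y" for y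
    using zw by (cases y; cases "\<theta> y") (auto simp: gelfand_space_def zw_eq)
  have const: "z $ i * w $ j = z $ i' * w $ j'" for i j i' j'
  proof -
    have "{y. z $ fst y * w $ snd y = z $ i' * w $ j'} = UNIV"
      by (rule cyclic_type_transitive[OF assms, of "(i', j')"]) (simp_all add: rel)
    then show ?thesis
      by (auto dest: eqset_imp_iff[of _ _ "(i, j)"])
  qed
  have "z = 0 \<or> w = 0 \<or> z \<in> diagonal \<and> w \<in> diagonal"
  proof (rule ccontr)
    assume neg: "\<not> ?thesis"
    then obtain i0 j0 where ij0: "z $ i0 \<noteq> 0" "w $ j0 \<noteq> 0"
      by (auto simp: vec_eq_iff)
    have "z \<in> diagonal"
      using const[of _ j0 _ j0] ij0 by (auto simp: diagonal_def)
    moreover have "w \<in> diagonal"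
      using const[of i0 _ i0] ij0 by (auto simp: diagonal_def)
    ultimately show False
      using neg by blast
  qed
  then show "zw \<in> cball 0 1 \<times> {0} \<union> {0} \<times> cball 0 1 \<union> (cball 0 1 \<inter> diagonal) \<times> (cball 0 1 \<inter> diagonal)"
    using zw by (auto simp: gelfand_space_def zw_eq)
next
  fix zw assume "zw \<in> cball (0 :: complex^'n) 1 \<times> {0 :: complex^'m} \<union> {0} \<times> cball 0 1 \<union>
    (cball 0 1 \<inter> diagonal) \<times> (cball 0 1 \<inter> diagonal)"
  then show "zw \<in> gelfand_space \<theta>"
    unfolding gelfand_space_def diagonal_def by (auto, metis)
qed

lemma product_conjugate_transitive:
  assumes "product_conjugate \<theta>1 \<theta>2" "cyclic_type \<theta>1" "x \<in> S" "\<And>y. y \<in> S \<Longrightarrow> \<theta>2 y \<in> S"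
  shows "S = UNIV"
proof -
  obtain \<sigma> \<tau> where bij: "bij \<sigma>" "bij \<tau>"
    and conj: "\<And>x. \<theta>2 (map_prod \<sigma> \<tau> x) = map_prod \<sigma> \<tau> (\<theta>1 x)"
    using assms(1) by (auto simp: product_conjugate_def)
  have "surj (map_prod \<sigma> \<tau>)"
    using bij by (metis bij_is_surj map_prod_surj)
  then obtain x' where "map_prod \<sigma> \<tau> x' = x"
    by (metis surjD)
  then have "map_prod \<sigma> \<tau> -` S = UNIV"
    using assms(3,4) by (intro cyclic_type_transitive[OF assms(2), of x']) (simp_all flip: conj)
  then show ?thesis
    using \<open>surj (map_prod \<sigma> \<tau>)\<close> by (metis surj_image_vimage_eq)
qed

lemma cycle_of_list_map:
  "inj_on f (insert x (set cs)) \<Longrightarrow>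
    cycle_of_list (map f cs) (f x) = f (cycle_of_list cs x) \<and> cycle_of_list cs x \<in> insert x (set cs)"
proof (induction cs rule: cycle_of_list.induct)
  case (1 i j cs)
  then have IH: "cycle_of_list (map f (j # cs)) (f x) = f (cycle_of_list (j # cs) x)"
    "cycle_of_list (j # cs) x \<in> insert x (set (j # cs))"
    by (auto simp: inj_on_def)
  have transp: "Transposition.transpose (f i) (f j) (f y) = f (Transposition.transpose i j y) \<and>
      Transposition.transpose i j y \<in> insert x (set (i # j # cs))" if "y \<in> insert x (set (i # j # cs))" for y
    using 1(2) that by (auto simp: Transposition.transpose_def inj_on_def)
  show ?case
    using transp[of "cycle_of_list (j # cs) x"] IH by auto
qed auto

lemma cell_cycle_eq_map_of_table:
  assumes "set cs \<subseteq> set cell_numbers"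
  shows "cell_cycle cs = map_of_table (cycle_table cs)"
proof
  fix c
  have sub: "insert (cell_number c) (set cs) \<subseteq> set cell_numbers"
    using assms cell_number_in by blast
  have "cell_cycle cs (cell (cell_number c)) = cell (cycle_of_list cs (cell_number c))"
    unfolding cell_cycle_def using cycle_of_list_map[OF inj_on_subset[OF inj_on_cell sub]] by blast
  then show "cell_cycle cs c = map_of_table (cycle_table cs) c"
    by (simp add: map_of_table_def cycle_table_def entry_map cell_number_in cell_cell_number)
qed

lemma representative_cycles_cell_numbers:
  "cs \<in> set representative_cycles \<Longrightarrow> distinct cs \<and> set cs = set cell_numbers"
proof -
  have "list_all (\<lambda>cs. distinct cs \<and> set cs = set cell_numbers) representative_cycles"
    by code_simp
  then show "cs \<in> set representative_cycles \<Longrightarrow> ?thesis"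
    by (simp add: list_all_iff)
qed

lemma cyclic_type_cell_cycle:
  assumes "cs \<in> set representative_cycles"
  shows "cyclic_type (cell_cycle cs)"
  unfolding cyclic_type_def cell_cycle_def
  using representative_cycles_cell_numbers[OF assms] inj_on_cell cell_surj
  by (intro exI[of _ "map cell cs"]) (simp add: distinct_map)

lemma representative_closed:
  assumes "q \<in> set representatives" "k \<in> set cell_numbers"
  shows "entry q k \<in> set cell_numbers"
proof -
  have "list_all (\<lambda>q. list_all (\<lambda>k. entry q k \<in> set cell_numbers) cell_numbers) representatives"
    by code_simp
  then show ?thesis
    using assms by (simp add: list_all_iff)
qed

text \<open>
  Each of these permutations has an orbit with at most three elements.
\<close>

lemma intransitive_representative:
  assumes "q \<in> set intransitive_representatives" "cyclic_type \<theta>"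
  shows "\<not> product_conjugate \<theta> (map_of_table q)"
proof
  assume conj: "product_conjugate \<theta> (map_of_table q)"
  have "list_all (\<lambda>q. list_ex (\<lambda>k. entry q (entry q (entry q k)) \<in> {k, entry q k}) cell_numbers) intransitive_representatives"
    by code_simp
  then obtain k where k: "k \<in> set cell_numbers" "entry q (entry q (entry q k)) \<in> {k, entry q k}"
    using assms(1) by (auto simp: list_all_iff list_ex_iff)
  have q: "entry q k \<in> set cell_numbers" if "k \<in> set cell_numbers" for k
    using representative_closed[of q k] assms(1) that by (simp add: representatives_def)
  let ?S = "{cell k, cell (entry q k), cell (entry q (entry q k))}"
  have "?S = UNIV"
    using k by (intro product_conjugate_transitive[OF conj assms(2), of "cell k"]) (auto simp: map_of_table_cell q)
  moreover have "card ?S \<le> 3"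
    by (simp add: card_insert_if)
  ultimately show False
    by simp
qed

lemma link_invariants_representative_inject:
  assumes "q \<in> set representatives" "q' \<in> set representatives"
    "link_invariants (map_of_table q) = link_invariants (map_of_table q')"
  shows "q = q'"
proof -
  have "signature q = signature q'"
    using assms link_invariants_map_of_table[OF representative_closed] by metis
  then show ?thesis
    using distinct_signatures assms(1,2) by (metis distinct_map inj_onD)
qed

lemma link_invariants_cong:
  assumes "\<And>R S a b. R \<in> {same_row, same_column} \<Longrightarrow> S \<in> {same_row, same_column} \<Longrightarrow>
    link_count R a S b \<theta>1 = link_count R a S b \<theta>2"
  shows "link_invariants \<theta>1 = link_invariants \<theta>2"
  unfolding link_invariants_def list.inject by (intro conjI HOL.refl assms) simp_all

text \<open>
  Equality of the invariants leads back to the semigroups through the representatives: both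
  permutations are product conjugate to the same one.
\<close>

theorem isomorphism_iff_link_invariants_eq:
  fixes \<theta>1 \<theta>2 :: "2 \<times> 3 \<Rightarrow> 2 \<times> 3"
  assumes "bij \<theta>1" "bij \<theta>2" "minimal_type \<theta>1" "minimal_type \<theta>2"
  shows "isometrically_isomorphic (toeplitz_algebra (two_graph \<theta>1)) (toeplitz_algebra (two_graph \<theta>2)) \<longleftrightarrow>
      link_invariants \<theta>1 = link_invariants \<theta>2"
    and "two_graph \<theta>1 \<cong> two_graph \<theta>2 \<longleftrightarrow> link_invariants \<theta>1 = link_invariants \<theta>2"
proof -
  have 1: "link_invariants \<theta>1 = link_invariants \<theta>2"
    if "isometrically_isomorphic (toeplitz_algebra (two_graph \<theta>1)) (toeplitz_algebra (two_graph \<theta>2))"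
    by (rule link_invariants_cong, rule isomorphic_imp_link_count_eq[OF _ _ assms that]) simp_all
  have 2: "two_graph \<theta>1 \<cong> two_graph \<theta>2" if eq: "link_invariants \<theta>1 = link_invariants \<theta>2"
  proof -
    obtain q1 where q1: "q1 \<in> set representatives" "product_conjugate \<theta>1 (map_of_table q1)"
      using conjugate_to_representative[OF assms(1,3)] .
    obtain q2 where q2: "q2 \<in> set representatives" "product_conjugate \<theta>2 (map_of_table q2)"
      using conjugate_to_representative[OF assms(2,4)] .
    have "link_invariants (map_of_table q1) = link_invariants (map_of_table q2)"
      using eq link_invariants_cong[OF product_conjugate_link_count[OF q1(2)]]
        link_invariants_cong[OF product_conjugate_link_count[OF q2(2)]] by simp
    then have "q1 = q2"
      using q1(1) q2(1) link_invariants_representative_inject by blast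
    have "two_graph \<theta>1 \<cong> two_graph (map_of_table q1)"
      using q1(2) by (rule product_conjugate_imp_two_graph_iso)
    also have "\<dots> \<cong> two_graph \<theta>2"
      unfolding \<open>q1 = q2\<close> by (rule product_conjugate_imp_two_graph_iso[OF product_conjugate_sym[OF q2(2)]])
    finally show ?thesis .
  qed
  have 3: "isometrically_isomorphic (toeplitz_algebra (two_graph \<theta>1)) (toeplitz_algebra (two_graph \<theta>2))"
    if "two_graph \<theta>1 \<cong> two_graph \<theta>2"
    using that assms(1,2)
    by (intro monoid_iso_imp_isometrically_isomorphic left_cancellative_two_graph)
  show "isometrically_isomorphic (toeplitz_algebra (two_graph \<theta>1)) (toeplitz_algebra (two_graph \<theta>2)) \<longleftrightarrow>
      link_invariants \<theta>1 = link_invariants \<theta>2"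
    using 1 2 3 by blast
  show "two_graph \<theta>1 \<cong> two_graph \<theta>2 \<longleftrightarrow> link_invariants \<theta>1 = link_invariants \<theta>2"
    using 1 2 3 by blast
qed

theorem theorem7p5:
  shows "(\<forall>\<theta> :: 2 \<times> 3 \<Rightarrow> 2 \<times> 3. cyclic_type \<theta> \<longrightarrow> minimal_type \<theta>) \<and>
    (\<forall>(\<theta>\<^sub>1 :: 2 \<times> 3 \<Rightarrow> 2 \<times> 3) (\<theta>\<^sub>2 :: 2 \<times> 3 \<Rightarrow> 2 \<times> 3).
       bij \<theta>\<^sub>1 \<and> bij \<theta>\<^sub>2 \<and>
       (cyclic_type \<theta>\<^sub>1 \<and> cyclic_type \<theta>\<^sub>2 \<or> minimal_type \<theta>\<^sub>1 \<and> minimal_type \<theta>\<^sub>2) \<longrightarrow>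
       (isometrically_isomorphic (toeplitz_algebra (two_graph \<theta>\<^sub>1)) (toeplitz_algebra (two_graph \<theta>\<^sub>2))
          \<longleftrightarrow> two_graph \<theta>\<^sub>1 \<cong> two_graph \<theta>\<^sub>2)) \<and>
    card (cyclic_perms // two_graph_iso) = 14 \<and>
    bij_betw (\<lambda>\<theta>. two_graph_iso `` {\<theta>})
       (cell_cycle `
         {[1,5,3,4,2,6], [1,4,2,5,3,6], [1,5,3,6,2,4], [1,2,3,6,5,4], [1,4,2,5,6,3],
          [1,2,5,4,3,6], [1,2,3,4,5,6], [1,2,3,4,6,5], [1,2,4,5,3,6], [1,2,4,5,6,3],
          [1,5,4,2,3,6], [1,2,4,6,5,3], [1,5,4,2,6,3], [1,2,6,4,3,5]})
       (cyclic_perms // two_graph_iso)"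
proof -
  let ?C = "cell_cycle ` set representative_cycles"
  have set: "{[1,5,3,4,2,6], [1,4,2,5,3,6], [1,5,3,6,2,4], [1,2,3,6,5,4], [1,4,2,5,6,3],
      [1,2,5,4,3,6], [1,2,3,4,5,6], [1,2,3,4,6,5], [1,2,4,5,3,6], [1,2,4,5,6,3],
      [1,5,4,2,3,6], [1,2,4,6,5,3], [1,5,4,2,6,3], [1,2,6,4,3,5]} = set representative_cycles"
    by (simp only: representative_cycles_def list.set)
  have cyclic: "cyclic_type \<theta> \<longleftrightarrow> \<theta> \<in> cyclic_perms" for \<theta>
    by (simp add: cyclic_perms_def)
  have iso: "(\<theta>1, \<theta>2) \<in> two_graph_iso \<longleftrightarrow>
      cyclic_type \<theta>1 \<and> cyclic_type \<theta>2 \<and> link_invariants \<theta>1 = link_invariants \<theta>2" for \<theta>1 \<theta>2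
    using isomorphism_iff_link_invariants_eq(2)[of \<theta>1 \<theta>2] cyclic_type_bij cyclic_type_imp_minimal_type
    by (auto simp: two_graph_iso_def cyclic_perms_def)
  have table: "cell_cycle cs = map_of_table (cycle_table cs)" "cycle_table cs \<in> set representatives"
    if "cs \<in> set representative_cycles" for cs
    using that representative_cycles_cell_numbers[OF that]
    by (simp_all add: cell_cycle_eq_map_of_table representatives_def)
  have inj: "\<theta>1 = \<theta>2" if "\<theta>1 \<in> ?C" "\<theta>2 \<in> ?C" "link_invariants \<theta>1 = link_invariants \<theta>2" for \<theta>1 \<theta>2
    using that table link_invariants_representative_inject by (smt (verit) imageE)
  have cyclic_C: "cyclic_type \<theta>" if "\<theta> \<in> ?C" for \<theta>
    using that cyclic_type_cell_cycle by blast
  have surj: "\<exists>\<theta>'\<in>?C. link_invariants \<theta> = link_invariants \<theta>'" if \<theta>: "cyclic_type \<theta>" for \<theta> :: "2 \<times> 3 \<Rightarrow> 2 \<times> 3"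
  proof -
    obtain q where q: "q \<in> set representatives" "product_conjugate \<theta> (map_of_table q)"
      using conjugate_to_representative[OF cyclic_type_bij[OF \<theta>] cyclic_type_imp_minimal_type[OF \<theta>]] .
    then have "q \<notin> set intransitive_representatives"
      using intransitive_representative[OF _ \<theta>] by blast
    then obtain cs where cs: "cs \<in> set representative_cycles" "q = cycle_table cs"
      using q(1) by (auto simp: representatives_def)
    have "link_invariants \<theta> = link_invariants (map_of_table q)"
      by (intro link_invariants_cong product_conjugate_link_count[OF q(2)])
    then show ?thesis
      using imageI[OF cs(1), of cell_cycle] table(1)[OF cs(1)] cs(2) by metis
  qed
  have bij: "bij_betw (\<lambda>\<theta>. two_graph_iso `` {\<theta>}) ?C (cyclic_perms // two_graph_iso)"
  proof (rule bij_betw_imageI)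
    show "inj_on (\<lambda>\<theta>. two_graph_iso `` {\<theta>}) ?C"
    proof (rule inj_onI)
      fix \<theta>1 \<theta>2 assume C: "\<theta>1 \<in> ?C" "\<theta>2 \<in> ?C" and "two_graph_iso `` {\<theta>1} = two_graph_iso `` {\<theta>2}"
      then have "(\<theta>1, \<theta>2) \<in> two_graph_iso"
        using iso cyclic_C by blast
      then show "\<theta>1 = \<theta>2"
        using inj C iso by blast
    qed
    have "two_graph_iso `` {\<theta>} \<in> (\<lambda>\<theta>. two_graph_iso `` {\<theta>}) ` ?C" if \<theta>: "cyclic_type \<theta>" for \<theta> :: "2 \<times> 3 \<Rightarrow> 2 \<times> 3"
    proof -
      obtain \<theta>' where \<theta>': "\<theta>' \<in> ?C" "link_invariants \<theta> = link_invariants \<theta>'"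
        using surj[OF \<theta>] by blast
      then have "two_graph_iso `` {\<theta>} = two_graph_iso `` {\<theta>'}"
        using \<theta> cyclic_C by (auto simp: iso)
      then show ?thesis
        using \<theta>'(1) by blast
    qed
    then have "(\<lambda>\<theta>. two_graph_iso `` {\<theta>}) ` cyclic_perms \<subseteq> (\<lambda>\<theta>. two_graph_iso `` {\<theta>}) ` ?C"
      by (auto simp only: cyclic)
    moreover have "(\<lambda>\<theta>. two_graph_iso `` {\<theta>}) ` ?C \<subseteq> (\<lambda>\<theta>. two_graph_iso `` {\<theta>}) ` cyclic_perms"
      by (rule image_mono) (use cyclic_C cyclic in blast)
    moreover have "cyclic_perms // two_graph_iso = (\<lambda>\<theta>. two_graph_iso `` {\<theta>}) ` cyclic_perms"
      by (auto simp: quotient_def)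
    ultimately show "(\<lambda>\<theta>. two_graph_iso `` {\<theta>}) ` ?C = cyclic_perms // two_graph_iso"
      by simp
  qed
  have "inj_on cell_cycle (set representative_cycles)"
  proof (rule inj_onI)
    fix cs cs' assume cs: "cs \<in> set representative_cycles" "cs' \<in> set representative_cycles"
      and "cell_cycle cs = cell_cycle cs'"
    then have "cycle_table cs = cycle_table cs'"
      using table link_invariants_representative_inject by metis
    moreover have "distinct (map cycle_table representative_cycles)"
      using distinct_signatures
      by (auto simp: representatives_def distinct_map dest: inj_on_imageI2)
    ultimately show "cs = cs'"
      using cs by (metis distinct_map inj_onD)
  qed
  then have "card ?C = card (set representative_cycles)"
    by (rule card_image)
  also have "\<dots> = 14"
    by (simp add: representative_cycles_def)
  finally have "card (cyclic_perms // two_graph_iso) = 14"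
    using bij_betw_same_card[OF bij] by simp
  moreover have "isometrically_isomorphic (toeplitz_algebra (two_graph \<theta>1)) (toeplitz_algebra (two_graph \<theta>2))
      \<longleftrightarrow> two_graph \<theta>1 \<cong> two_graph \<theta>2"
    if "bij \<theta>1 \<and> bij \<theta>2 \<and> (cyclic_type \<theta>1 \<and> cyclic_type \<theta>2 \<or> minimal_type \<theta>1 \<and> minimal_type \<theta>2)"
    for \<theta>1 \<theta>2 :: "2 \<times> 3 \<Rightarrow> 2 \<times> 3"
    using that isomorphism_iff_link_invariants_eq[of \<theta>1 \<theta>2] cyclic_type_imp_minimal_type by blast
  ultimately show ?thesis
    unfolding set using bij cyclic_type_imp_minimal_type by blast
qed

end
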